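(* Let $\gamma_1>0$, $\gamma_2>0$, $\bm{\Sigma}_0\in\mathbb{S}^p_{++}$, and let $h(\bm{x},\bm{\xi})=\max_{1\le k\le K}\{\bm{a}_k(\bm{x})^T\bm{\xi}+b_k(\bm{x})\}$ with $\bm{a}_k(\bm{x})\in\mathbb{R}^p$ and $b_k(\bm{x})\in\mathbb{R}$ linear in $\bm{x}$ for all $k$. Let the core sets and the sample space be $Y_i=\{\bm{\xi}_i+\bm{A}_i\bm{\zeta}\mid\bm{\zeta}\in Z_{1i}\}$, $i=1,\dots,m$, and $\Xi=\{\bm{\xi}_0+\bm{A}\bm{\zeta}\mid\bm{\zeta}\in Z_2\}$, and let $$\mathcal{D}_M=\left\{P\in\mathcal{P}(\Xi)\ \middle|\ \begin{array}{l}(E_P[\bm{\xi}]-\bm{\mu}_0)^T\bm{\Sigma}_0^{-1}(E_P[\bm{\xi}]-\bm{\mu}_0)\le\gamma_1,\\ E_P[(\bm{\xi}-\bm{\mu}_0)(\bm{\xi}-\bm{\mu}_0)^T]\preceq\gamma_2\bm{\Sigma}_0,\\ P(\bm{\xi}\in\Xi)=1\end{array}\right\}.$$ Assume that for each fixed $\bm{x}\in X$ the function $\bm{\xi}\mapsto h(\bm{x},\bm{\xi})-\min_{1\le i\le m}\theta_i\min_{\bm{\xi}'\in Y_i}\phi_i(\bm{\xi},\bm{\xi}')$ is $P$-integrable for all $P\in\mathcal{D}_M$. Then the problem $$\min_{\bm{x}\in X}\ \max_{P\in\mathcal{D}_M}\ E_P\Big[h(\bm{x},\bm{\xi})-\min_{1\le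 i\le m}\theta_i\min_{\bm{\xi}'\in Y_i}\phi_i(\bm{\xi},\bm{\xi}')\Big]$$ can be equivalently reformulated as $$\min_{\bm{x},\bm{\Lambda},\bm{q},t,\bm{v}_{ik},\bm{w}_{ik},z^1_{ik},z^2_{ik}}\ \ t+\bm{\Lambda}\cdot(\gamma_2\bm{\Sigma}_0+\bm{\mu}_0\bm{\mu}_0^T)+\sqrt{\gamma_1}\,\|\bm{\Sigma}_0^{1/2}(\bm{q}+2\bm{\Lambda}\bm{\mu}_0)\|_2+\bm{q}^T\bm{\mu}_0$$ subject to, for all $1\le k\le K$ and $1\le i\le m$, $$\begin{bmatrix}\bm{\Lambda}&\frac12(\bm{v}_{ik}+\bm{w}_{ik}+\bm{q}-\bm{a}_k(\bm{x}))\\ \frac12(\bm{v}_{ik}+\bm{w}_{ik}+\bm{q}-\bm{a}_k(\bm{x}))^T& t-b_k(\bm{x})-\bm{\xi}_i^T\bm{v}_{ik}-\bm{\xi}_0^T\bm{w}_{ik}-\theta_i\phi_i^{**}\big(\tfrac{\bm{v}_{ik}}{\theta_i},-\tfrac{\bm{v}_{ik}}{\theta_i}\big)-z^1_{ik}-z^2_{ik}\end{bmatrix}\succeq0,$$ $$\delta^*(\bm{A}_i^T\bm{v}_{ik}|Z_{1i})\le z^1_{ik},\qquad \delta^*(\bm{A}^T\bm{w}_{ik}|Z_2)\le z^2_{ik},\qquad \bm{v}_{ik},\bm{w}_{ik}\in\mathbb{R}^p,\quad z^1_{ik},z^2_{ik}\in\mathbb{R},$$ and $\bm{\Lambda}\in\mathbb{S}^p_+$,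 $\bm{q}\in\mathbb{R}^p$, $t\in\mathbb{R}$, $\bm{x}\in X$. That is, for each $\bm{x}\in X$ the inner maximum over $P\in\mathcal{D}_M$ equals the minimum of the second problem over its remaining variables with $\bm{x}$ fixed, so the two problems have the same optimal value and the same optimal decisions $\bm{x}$.
   Context: Notation and standing assumptions. $X\subseteq\mathbb{R}^n$ is a closed convex set. $\mathbb{S}^p_+$ and $\mathbb{S}^p_{++}$ are the sets of positive semidefinite and positive definite real symmetric $p\times p$ matrices; $\bm{B}\preceq\bm{C}$ means $\bm{C}-\bm{B}$ is positive semidefinite; $\bm{\Lambda}\cdot\bm{B}$ is the trace inner product. $\bm{\Sigma}_0^{1/2}$ is a matrix with $\bm{\Sigma}_0=(\bm{\Sigma}_0^{1/2})^T\bm{\Sigma}_0^{1/2}$. $\mathcal{P}(\Xi)$ is the set of all probability measures on $(\Xi,\mathcal{B}(\Xi))$, with $\mathcal{B}(\Xi)$ the Borel $\sigma$-algebra of $\Xi\subseteq\mathbb{R}^p$; $\bm{\xi}$ is the identity random vector on $\Xi$ and $E_P$ denotes expectation under $P$. $\bm{\mu}_0\in\mathbb{R}^p$ and $\bm{\Sigma}_0$ are the sample mean and sample covariance matrix of samples $\hat{\bm{\xi}}_1,\dots,\hat{\bm{\xi}}_N\in\Xi$ (so $\bm{\mu}_0\in\Xi$, since $\Xi$ is convex). Sets: $\bm{\xi}_0,\bm{\xi}_1,\dots,\bm{\xi}_m\in\mathbb{R}^p$ and $\bm{A},\bm{A}_1,\dots,\bm{A}_m\in\mathbb{R}^{p\times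 L}$ are given; each $Z_{1i}\subseteq\mathbb{R}^L$ is nonempty, convex and compact with $0$ in its relative interior; $Z_2\subseteq\mathbb{R}^L$ is convex; and these data satisfy $Y_i\subseteq\Xi$ for all $i$. Penalties: $\theta_i>0$, and each $\phi_i:\mathbb{R}^p\times\mathbb{R}^p\to\mathbb{R}$ is closed, jointly convex and nonnegative, with $\phi_i(\bm{\xi},\bm{\xi})=0$ for all $\bm{\xi}\in\mathbb{R}^p$. Conjugates: $\phi_i^{**}(\bm{u},\bm{u}')=\sup_{\bm{\xi},\bm{\xi}'\in\mathbb{R}^p}\{\bm{u}^T\bm{\xi}+\bm{u}'^T\bm{\xi}'-\phi_i(\bm{\xi},\bm{\xi}')\}$ is the convex conjugate of $\phi_i$ with respect to both variables jointly (not the biconjugate), and $\delta^*(\bm{u}|S)=\sup_{\bm{\zeta}\in S}\bm{u}^T\bm{\zeta}$ is the support function of $S$ (the conjugate of its indicator function). Both may take the value $+\infty$; a constraint in which such a term equals $+\infty$ is regarded as violated. The outer "min" and inner "max" in the optimization problems denote infimum and supremum. *)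

theory Defs
  imports "HOL-Analysis.Analysis" "HOL-Probability.Probability"
begin

definition outer :: "real^'p \<Rightarrow> real^'p \<Rightarrow> real^'p^'p" where
  "outer u v = (\<chi> i j. u $ i * v $ j)"

definition psd :: "real^'p^'p \<Rightarrow> bool" where
  "psd A \<longleftrightarrow> transpose A = A \<and> (\<forall>x. 0 \<le> x \<bullet> (A *v x))"

definition pd :: "real^'p^'p \<Rightarrow> bool" where
  "pd A \<longleftrightarrow> transpose A = A \<and> (\<forall>x. x \<noteq> 0 \<longrightarrow> 0 < x \<bullet> (A *v x))"

definition loewner_le :: "real^'p^'p \<Rightarrow> real^'p^'p \<Rightarrow> bool"  (infix "\<preceq>" 50) where
  "B \<preceq> C \<longleftrightarrow> psd (C - B)"

definition trace_inner :: "real^'p^'p \<Rightarrow> real^'p^'p \<Rightarrow> real" where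
  "trace_inner A B = trace (transpose A ** B)"

text \<open>The block matrix with upper left block \<open>M\<close>, last column \<open>(u, s)\<close> and last row \<open>(u, s)\<close>;
  the index \<open>None\<close> stands for the additional coordinate.\<close>

definition bordered :: "real^'p^'p \<Rightarrow> real^'p \<Rightarrow> real \<Rightarrow> real^('p option)^('p option)" where
  "bordered M u s = (\<chi> i j. case (i, j) of
      (Some i', Some j') \<Rightarrow> M $ i' $ j'
    | (Some i', None) \<Rightarrow> u $ i'
    | (None, Some j') \<Rightarrow> u $ j'
    | (None, None) \<Rightarrow> s)"

text \<open>For a function of two vector arguments, given as a function on pairs, this is the conjugate
  with respect to both arguments jointly, because the inner product of pairs is the sum of
  the componentwise inner products.\<close>

definition conjugate :: "('a::real_inner \<Rightarrow> real) \<Rightarrow> 'a \<Rightarrow> ereal" where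
  "conjugate f u = (SUP z. ereal (u \<bullet> z - f z))"

definition support_fun :: "'a::real_inner \<Rightarrow> 'a set \<Rightarrow> ereal" where
  "support_fun u S = (SUP z\<in>S. ereal (u \<bullet> z))"

definition sample_mean :: "nat \<Rightarrow> (nat \<Rightarrow> real^'p) \<Rightarrow> real^'p" where
  "sample_mean N s = (1 / real N) *\<^sub>R (\<Sum>j=1..N. s j)"

text \<open>The divisor \<open>d\<close> is a parameter, since both \<open>N\<close> and \<open>N - 1\<close> are in use.\<close>

definition sample_covariance :: "real \<Rightarrow> nat \<Rightarrow> (nat \<Rightarrow> real^'p) \<Rightarrow> real^'p^'p" where
  "sample_covariance d N s =
     (1 / d) *\<^sub>R (\<Sum>j=1..N. outer (s j - sample_mean N s) (s j - sample_mean N s))"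

definition prob_measures :: "(real^'p) set \<Rightarrow> (real^'p) measure set" where
  "prob_measures \<Xi> = {P. prob_space P \<and> sets P = sets (restrict_space borel \<Xi>)}"

text \<open>The Bochner integral of a non-integrable function is \<open>0\<close>; the two integrability
  conditions say that the expectations in the moment constraints exist.\<close>

definition moment_set ::
    "(real^'p) set \<Rightarrow> real^'p \<Rightarrow> real^'p^'p \<Rightarrow> real \<Rightarrow> real \<Rightarrow> (real^'p) measure set" where
  "moment_set \<Xi> \<mu>\<^sub>0 \<Sigma>\<^sub>0 \<gamma>\<^sub>1 \<gamma>\<^sub>2 = {P \<in> prob_measures \<Xi>.
     integrable P (\<lambda>\<xi>. \<xi>) \<and>
     ((\<integral>\<xi>. \<xi> \<partial>P) - \<mu>\<^sub>0) \<bullet> (matrix_inv \<Sigma>\<^sub>0 *v ((\<integral>\<xi>. \<xi> \<partial>P) - \<mu>\<^sub>0)) \<le> \<gamma>\<^sub>1 \<and>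
     integrable P (\<lambda>\<xi>. outer (\<xi> - \<mu>\<^sub>0) (\<xi> - \<mu>\<^sub>0)) \<and>
     (\<integral>\<xi>. outer (\<xi> - \<mu>\<^sub>0) (\<xi> - \<mu>\<^sub>0) \<partial>P) \<preceq> \<gamma>\<^sub>2 *\<^sub>R \<Sigma>\<^sub>0 \<and>
     measure P {\<xi> \<in> space P. \<xi> \<in> \<Xi>} = 1}"

end

theory Submission
  imports Defs
begin

text \<open>For fixed \<open>x\<close> the inner maximum is a moment problem whose Lagrangian dual minimises over the
  quadratic majorants \<open>t + q \<bullet> \<xi> + \<xi> \<bullet> \<Lambda>\<xi>\<close> of the integrand on \<open>\<Xi>\<close>; strong duality with
  attainment follows by separation in the finite-dimensional space of moments, with the Dirac measure
  at \<open>\<mu>\<^sub>0\<close> as Slater point. The integrand is a maximum over \<open>i\<close>, \<open>k\<close> and \<open>\<xi>' \<in> Y i\<close>, so being a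
  majorant means that finitely many functions, each jointly convex in \<open>(\<xi>, \<xi>')\<close>, are nonnegative on
  \<open>\<Xi> \<times> Y i\<close>. As the penalties are finite everywhere, Fenchel duality turns each of these conditions,
  without a constraint qualification, into the existence of multipliers \<open>v\<close> and \<open>w\<close> for which a
  quadratic polynomial is nonnegative on the whole space, which is the matrix inequality.\<close>

section \<open>Positive semidefinite matrices\<close>

text \<open>Lets bilinearity, Cauchy-Schwarz and hyperplane separation, all available for
  \<open>\<bullet>\<close> on matrices, act on the trace product.\<close>

lemma trace_inner_eq_inner: "trace_inner A B = A \<bullet> B"
proof -
  have "trace_inner A B = (\<Sum>i\<in>UNIV. \<Sum>k\<in>UNIV. A $ k $ i * B $ k $ i)"
    by (simp add: trace_inner_def trace_def matrix_matrix_mult_def transpose_def)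
  also have "\<dots> = (\<Sum>k\<in>UNIV. \<Sum>i\<in>UNIV. A $ k $ i * B $ k $ i)"
    by (rule sum.swap)
  finally show ?thesis by (simp add: inner_vec_def)
qed

text \<open>For \<open>x = y\<close> a quadratic form becomes a linear functional of
  \<open>outer x x\<close>; hence integrating a quadratic majorant involves only first and second
  moments.\<close>

lemma inner_outer: "M \<bullet> outer x y = x \<bullet> (M *v y)"
  by (simp add: inner_vec_def outer_def matrix_vector_mult_def sum_distrib_left algebra_simps)

lemma inner_transpose_transpose: "transpose A \<bullet> transpose B = A \<bullet> (B :: real^'n^'m)"
proof -
  have "transpose A \<bullet> transpose B = (\<Sum>i\<in>UNIV. \<Sum>j\<in>UNIV. A $ j $ i * B $ j $ i)"
    by (simp add: inner_vec_def transpose_def)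
  also have "\<dots> = A \<bullet> B"
    by (subst sum.swap) (simp add: inner_vec_def)
  finally show ?thesis .
qed

lemma outer_mult_vec: "outer x y *v z = (y \<bullet> z) *\<^sub>R x"
  by (simp add: vec_eq_iff inner_vec_def outer_def matrix_vector_mult_def sum_distrib_left
      sum_distrib_right algebra_simps)

lemma transpose_outer: "transpose (outer x y) = outer y x"
  by (simp add: transpose_def outer_def vec_eq_iff)

lemma norm_outer: "norm (outer x y) = norm x * norm y"
proof -
  have "outer x y \<bullet> outer x y = (x \<bullet> x) * (y \<bullet> y)"
    by (simp add: inner_outer outer_mult_vec)
  then show ?thesis
    by (simp add: norm_eq_sqrt_inner real_sqrt_mult)
qed

lemma psd_inner_commute:
  assumes "psd M"
  shows "x \<bullet> (M *v y) = y \<bullet> (M *v x)"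
  using assms by (metis psd_def dot_lmul_matrix inner_commute transpose_matrix_vector)

text \<open>The form is nonnegative on every combination of \<open>x\<close> and \<open>y\<close>,
  so its discriminant in \<open>r\<close> and \<open>s\<close> has a sign.\<close>

lemma psd_Cauchy_Schwarz:
  assumes "psd M"
  shows "(x \<bullet> (M *v y))\<^sup>2 \<le> (x \<bullet> (M *v x)) * (y \<bullet> (M *v y))"
proof -
  let ?a = "y \<bullet> (M *v y)" and ?b = "x \<bullet> (M *v y)" and ?c = "x \<bullet> (M *v x)"
  have nonneg: "0 \<le> s\<^sup>2 * ?c - 2 * s * r * ?b + r\<^sup>2 * ?a" for r s
  proof -
    have "0 \<le> (s *\<^sub>R x - r *\<^sub>R y) \<bullet> (M *v (s *\<^sub>R x - r *\<^sub>R y))"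
      using assms unfolding psd_def by blast
    also have "\<dots> = s\<^sup>2 * ?c - s * r * ?b - r * s * (y \<bullet> (M *v x)) + r\<^sup>2 * ?a"
      by (simp add: matrix_vector_mult_diff_distrib matrix_vector_mult_scaleR inner_diff_left
          inner_diff_right power2_eq_square algebra_simps)
    finally show ?thesis
      using psd_inner_commute[OF assms, of x y] by (simp add: algebra_simps)
  qed
  have a: "0 \<le> ?a" using assms unfolding psd_def by blast
  show ?thesis
  proof (cases "?a = 0")
    case False
    \<comment> \<open>With \<open>s = ?a\<close> and \<open>r = ?b\<close> the form equals the
      claimed difference times one factor \<open>?a\<close>, to be cancelled.\<close>
    then have "0 \<le> ?a * (?a * ?c - ?b\<^sup>2)"
      using nonneg[of ?a ?b] by (simp add: power2_eq_square algebra_simps)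
    then show ?thesis using a False by (simp add: zero_le_mult_iff algebra_simps)
  next
    case True
    have "?b = 0"
    proof (rule ccontr)
      assume "?b \<noteq> 0"
      \<comment> \<open>With \<open>?a = 0\<close> the form is affine in \<open>r\<close> for
        \<open>s = 1\<close>; this \<open>r\<close> gives it the value -1.\<close>
      then show False
        using nonneg[of 1 "(?c + 1) / (2 * ?b)"] True by simp
    qed
    then show ?thesis by (simp add: True)
  qed
qed

text \<open>Cauchy-Schwarz tested with \<open>x = M *v y\<close> bounds the square of
  \<open>x \<bullet> x\<close> by zero.\<close>

lemma psd_kernelI:
  assumes "psd M" "y \<bullet> (M *v y) = 0"
  shows "M *v y = 0"
  using psd_Cauchy_Schwarz[OF assms(1), of "M *v y" y] assms(2) by simp

text \<open>Self-duality of the cone of positive semidefinite matrices, by symmetric Gaussian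
  elimination: subtracting a rank-one matrix annihilates one more basis vector.\<close>

lemma psd_inner_nonneg:
  fixes L M :: "real^'p^'p"
  assumes "psd L" "psd M"
  shows "0 \<le> L \<bullet> M"
  using assms(1)
proof (induction "card {i. L *v axis i 1 \<noteq> 0}" arbitrary: L rule: less_induct)
  case less
  show ?case
  proof (cases "\<exists>i. L *v axis i 1 \<noteq> 0")
    case False
    then have "\<forall>i j. L $ j $ i = 0"
      by (simp add: matrix_vector_mult_basis column_def vec_eq_iff)
    then have "L = 0" by (simp add: vec_eq_iff)
    then show ?thesis by simp
  next
    case True
    then obtain i where i: "L *v axis i 1 \<noteq> 0" by blast
    define e :: "real^'p" where "e = axis i 1"
    define u where "u = L *v e"
    define \<alpha> where "\<alpha> = e \<bullet> (L *v e)"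
    \<comment> \<open>A zero pivot would put \<open>e\<close> in the kernel of \<open>L\<close>,
      against the choice of \<open>i\<close>.\<close>
    have "\<alpha> \<noteq> 0"
      using psd_kernelI[OF less.prems, of e] i by (auto simp: \<alpha>_def e_def)
    moreover have "0 \<le> \<alpha>"
      using less.prems by (auto simp: \<alpha>_def psd_def)
    ultimately have \<alpha>: "0 < \<alpha>" by simp
    define L' where "L' = L - (1/\<alpha>) *\<^sub>R outer u u"
    have L'v: "L' *v x = L *v x - ((e \<bullet> (L *v x)) / \<alpha>) *\<^sub>R u" for x
      using psd_inner_commute[OF less.prems, of e x]
      by (simp add: L'_def u_def matrix_vector_mult_diff_rdistrib scaleR_matrix_vector_assoc[symmetric]
          outer_mult_vec inner_commute)
    have "transpose L' = L'"
      using less.prems by (simp add: L'_def psd_def transpose_outer transpose_def outer_def vec_eq_iff mult.commute)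
    moreover have "0 \<le> x \<bullet> (L' *v x)" for x
    proof -
      have "x \<bullet> (L' *v x) = x \<bullet> (L *v x) - (x \<bullet> (L *v e))\<^sup>2 / \<alpha>"
        using psd_inner_commute[OF less.prems, of e x]
        by (simp add: L'v inner_diff_right u_def power2_eq_square)
      \<comment> \<open>Cauchy-Schwarz against the pivot vector: the rank-one correction preserves
        semidefiniteness.\<close>
      moreover have "(x \<bullet> (L *v e))\<^sup>2 / \<alpha> \<le> x \<bullet> (L *v x)"
        using psd_Cauchy_Schwarz[OF less.prems, of x e] \<alpha>
        by (simp add: divide_le_eq flip: \<alpha>_def)
      ultimately show ?thesis by simp
    qed
    ultimately have psd': "psd L'" by (simp add: psd_def)
    have "L' *v axis j 1 = 0" if "L *v axis j 1 = 0" for j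
      using that by (simp add: L'v)
    moreover have "L' *v axis i 1 = 0"
      using \<alpha> by (simp add: L'v u_def flip: e_def \<alpha>_def)
    ultimately have "{j. L' *v axis j 1 \<noteq> 0} \<subset> {j. L *v axis j 1 \<noteq> 0}"
      using i by auto
    then have "0 \<le> L' \<bullet> M"
      by (intro less.hyps[OF _ psd'] psubset_card_mono) auto
    moreover have "0 \<le> u \<bullet> (M *v u)"
      using assms(2) by (auto simp: psd_def)
    \<comment> \<open>The removed rank-one part pairs with \<open>M\<close> to a value of the
      quadratic form of \<open>M\<close>.\<close>
    moreover have "L \<bullet> M = L' \<bullet> M + (u \<bullet> (M *v u)) / \<alpha>"
      by (simp add: L'_def inner_diff_left inner_commute[of "outer u u"] inner_outer)
    ultimately show ?thesis using \<alpha> by simp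
  qed
qed

text \<open>The form of the bordered matrix at \<open>(x, \<tau>)\<close> is the homogenised
  polynomial: \<open>\<tau> \<noteq> 0\<close> reduces to \<open>\<tau> = 1\<close> by scaling, and
  \<open>\<tau> = 0\<close> is covered by \<open>psd M\<close>, which also carries the
  symmetry.\<close>

lemma psd_bordered_iff:
  fixes M :: "real^'p^'p"
  shows "psd (bordered M u s) \<longleftrightarrow> psd M \<and> (\<forall>x. 0 \<le> x \<bullet> (M *v x) + 2 * (u \<bullet> x) + s)"
proof -
  define vec where "vec x \<tau> = (\<chi> j. case j of Some i \<Rightarrow> x $ i | None \<Rightarrow> \<tau>)"
    for x :: "real^'p" and \<tau> :: real
  have vec_surj: "\<exists>x \<tau>. y = vec x \<tau>" for y
    by (rule exI[of _ "\<chi> i. y $ Some i"], rule exI[of _ "y $ None"])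
       (auto simp: vec_def vec_eq_iff split: option.split)
  have sum_option: "(\<Sum>j\<in>UNIV. f j) = f None + (\<Sum>i\<in>UNIV. f (Some i))"
    for f :: "'p option \<Rightarrow> real"
    by (simp add: UNIV_option_conv sum.reindex)
  have form: "vec x \<tau> \<bullet> (bordered M u s *v vec x \<tau>) =
      x \<bullet> (M *v x) + 2 * \<tau> * (u \<bullet> x) + \<tau>\<^sup>2 * s" for x \<tau>
    by (simp add: vec_def bordered_def inner_vec_def matrix_vector_mult_def sum_option
        sum_distrib_left sum.distrib power2_eq_square algebra_simps)
  have symm: "transpose (bordered M u s) = bordered M u s \<longleftrightarrow> transpose M = M"
    by (auto simp: transpose_def bordered_def vec_eq_iff split: option.splits)
  have "0 \<le> x \<bullet> (M *v x) + 2 * \<tau> * (u \<bullet> x) + \<tau>\<^sup>2 * s"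
    if "psd M" "\<forall>x. 0 \<le> x \<bullet> (M *v x) + 2 * (u \<bullet> x) + s" for x \<tau>
  proof (cases "\<tau> = 0")
    case True
    then show ?thesis using that(1) by (simp add: psd_def)
  next
    case False
    have "0 \<le> \<tau>\<^sup>2 * (((1/\<tau>) *\<^sub>R x) \<bullet> (M *v ((1/\<tau>) *\<^sub>R x)) + 2 * (u \<bullet> ((1/\<tau>) *\<^sub>R x)) + s)"
      using that(2) by (simp only: zero_le_mult_iff zero_le_power2) blast
    also have "\<dots> = x \<bullet> (M *v x) + 2 * \<tau> * (u \<bullet> x) + \<tau>\<^sup>2 * s"
      using False by (simp add: matrix_vector_mult_scaleR field_simps power2_eq_square)
    finally show ?thesis .
  qed
  moreover have "psd M \<and> (\<forall>x. 0 \<le> x \<bullet> (M *v x) + 2 * (u \<bullet> x) + s)"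
    if "psd (bordered M u s)"
  proof -
    have "0 \<le> vec x \<tau> \<bullet> (bordered M u s *v vec x \<tau>)" for x \<tau>
      using that by (simp add: psd_def)
    from this[unfolded form, of _ 0] this[unfolded form, of _ 1] show ?thesis
      using that by (simp add: psd_def symm)
  qed
  moreover have "psd (bordered M u s)"
    if "psd M" "\<And>x \<tau>. 0 \<le> x \<bullet> (M *v x) + 2 * \<tau> * (u \<bullet> x) + \<tau>\<^sup>2 * s"
    unfolding psd_def
  proof safe
    show "transpose (bordered M u s) = bordered M u s"
      using that(1) by (simp add: symm psd_def)
    fix y show "0 \<le> y \<bullet> (bordered M u s *v y)"
      using vec_surj[of y] that(2) by (auto simp: form)
  qed
  ultimately show ?thesis by blast
qed

section \<open>Separation and conjugate functions\<close>

text \<open>A hyperplane separates the strict epigraph of \<open>f\<close> from the hypograph of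
  \<open>- g\<close> over \<open>S\<close>. As \<open>f\<close> is finite on the whole space, the
  hyperplane cannot be vertical, whatever the position of \<open>S\<close>.\<close>

lemma convex_sandwich:
  fixes f g :: "'a::euclidean_space \<Rightarrow> real"
  assumes f: "convex_on UNIV f" and g: "convex_on S g" and S: "S \<noteq> {}"
    and le: "\<And>z. z \<in> S \<Longrightarrow> - g z \<le> f z"
  obtains u \<beta> where "\<And>z. u \<bullet> z + \<beta> \<le> f z" "\<And>z. z \<in> S \<Longrightarrow> - g z \<le> u \<bullet> z + \<beta>"
proof -
  let ?E = "{(z, r). f z < r}" and ?H = "{(z, r). z \<in> S \<and> r \<le> - g z}"
  have "convex ?E"
    unfolding convex_alt
  proof (clarsimp)
    fix z r z' r' and \<tau> :: real
    assume *: "f z < r" "f z' < r'" "0 \<le> \<tau>" "\<tau> \<le> 1"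
    have "f ((1 - \<tau>) *\<^sub>R z + \<tau> *\<^sub>R z') \<le> (1 - \<tau>) * f z + \<tau> * f z'"
      using convex_onD[OF f] * by simp
    also have "\<dots> < (1 - \<tau>) * r + \<tau> * r'"
    proof (cases "\<tau> = 0")
      case False
      then have "\<tau> * f z' < \<tau> * r'" "(1 - \<tau>) * f z \<le> (1 - \<tau>) * r"
        using * by (auto intro!: mult_left_mono)
      then show ?thesis by simp
    qed (use * in simp)
    finally show "f ((1 - \<tau>) *\<^sub>R z + \<tau> *\<^sub>R z') < (1 - \<tau>) * r + \<tau> * r'" .
  qed
  moreover have "convex ?H"
    unfolding convex_alt
  proof (clarsimp)
    fix z r z' r' and \<tau> :: real
    assume *: "z \<in> S" "z' \<in> S" "r \<le> - g z" "r' \<le> - g z'" "0 \<le> \<tau>" "\<tau> \<le> 1"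
    have "g ((1 - \<tau>) *\<^sub>R z + \<tau> *\<^sub>R z') \<le> (1 - \<tau>) * g z + \<tau> * g z'"
      using convex_onD[OF g] * by simp
    moreover have "(1 - \<tau>) * r \<le> (1 - \<tau>) * - g z" "\<tau> * r' \<le> \<tau> * - g z'"
      using * by (intro mult_left_mono; simp)+
    moreover have "(1 - \<tau>) *\<^sub>R z + \<tau> *\<^sub>R z' \<in> S"
      using g * unfolding convex_on_def convex_alt by blast
    ultimately show "(1 - \<tau>) *\<^sub>R z + \<tau> *\<^sub>R z' \<in> S \<and>
        (1 - \<tau>) * r + \<tau> * r' \<le> - g ((1 - \<tau>) *\<^sub>R z + \<tau> *\<^sub>R z')"
      by simp
  qed
  moreover have "?E \<inter> ?H = {}" using le by fastforce
  moreover have "(z, f z + 1) \<in> ?E" for z by simp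
  then have "?E \<noteq> {}" by blast
  moreover obtain z0 where z0: "z0 \<in> S" using S by blast
  then have "(z0, - g z0) \<in> ?H" by simp
  then have "?H \<noteq> {}" by blast
  ultimately obtain p c where "p \<noteq> 0" and sep: "\<forall>x\<in>?H. p \<bullet> x \<le> c" "\<forall>x\<in>?E. c \<le> p \<bullet> x"
    using separating_hyperplane_sets[of ?H ?E] by (auto simp: Int_commute)
  obtain v \<rho> where p: "p = (v, \<rho>)" by fastforce
  have H: "v \<bullet> z + \<rho> * r \<le> c" if "z \<in> S" "r \<le> - g z" for z r
    using sep(1) that by (auto simp: p)
  have E: "c \<le> v \<bullet> z + \<rho> * r" if "f z < r" for z r
    using sep(2) that by (auto simp: p)
  \<comment> \<open>The epigraph is unbounded upwards, so a negative \<open>\<rho>\<close> would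
    break the lower bound \<open>c\<close> above \<open>z0\<close>.\<close>
  have "0 \<le> \<rho>"
  proof (rule ccontr)
    assume "\<not> 0 \<le> \<rho>"
    then have neg: "\<rho> < 0" by simp
    let ?r = "max (f z0 + 1) ((c - v \<bullet> z0 - 1) / \<rho>)"
    have "\<rho> * ?r \<le> \<rho> * ((c - v \<bullet> z0 - 1) / \<rho>)"
      using neg by (intro mult_left_mono_neg) auto
    then have "\<rho> * ?r \<le> c - v \<bullet> z0 - 1" using neg by simp
    moreover have "f z0 < ?r" by (simp add: less_max_iff_disj)
    ultimately show False using E[of z0 ?r] by simp
  qed
  moreover have "\<rho> \<noteq> 0"
  proof
    assume 0: "\<rho> = 0"
    then have "v \<noteq> 0" using \<open>p \<noteq> 0\<close> by (simp add: p zero_prod_def)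
    \<comment> \<open>At this multiple of \<open>v\<close> a vertical hyperplane's functional drops
      to \<open>c - 1\<close>, although the epigraph has points above every
      \<open>z\<close>.\<close>
    then have "v \<bullet> (((c - 1) / (v \<bullet> v)) *\<^sub>R v) = c - 1" by simp
    with E[of "((c - 1) / (v \<bullet> v)) *\<^sub>R v" "f (((c - 1) / (v \<bullet> v)) *\<^sub>R v) + 1"] 0 show False by simp
  qed
  ultimately have \<rho>: "0 < \<rho>" by simp
  show ?thesis
  proof
    show "(- (1 / \<rho>) *\<^sub>R v) \<bullet> z + c / \<rho> \<le> f z" for z
    \<comment> \<open>The epigraph is strict, so the bound at \<open>f z\<close> itself is obtained
      as a limit.\<close>
    proof (rule field_le_epsilon)
      fix e :: real assume "0 < e"
      then have "c \<le> v \<bullet> z + \<rho> * (f z + e)" by (intro E) simp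
      then show "(- (1 / \<rho>) *\<^sub>R v) \<bullet> z + c / \<rho> \<le> f z + e" using \<rho> by (simp add: field_simps)
    qed
    show "- g z \<le> (- (1 / \<rho>) *\<^sub>R v) \<bullet> z + c / \<rho>" if "z \<in> S" for z
      using H[OF that order_refl] \<rho> by (simp add: field_simps)
  qed
qed

lemma inner_bounded_imp_zero:
  fixes u :: "'a::real_inner"
  assumes "\<And>x. u \<bullet> x \<le> \<beta>"
  shows "u = 0"
proof (rule ccontr)
  assume "u \<noteq> 0"
  then show False using assms[of "((\<beta> + 1) / (u \<bullet> u)) *\<^sub>R u"] by simp
qed

section \<open>Conjugates and support functions as extended reals\<close>

lemma conjugate_ge: "ereal (u \<bullet> z - f z) \<le> conjugate f u"
  unfolding conjugate_def by (rule SUP_upper) simp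

text \<open>The point 0 keeps the conjugate above minus infinity, so excluding plus infinity leaves
  a real number.\<close>

lemma conjugate_real:
  assumes "conjugate f u < \<infinity>"
  shows "ereal (real_of_ereal (conjugate f u)) = conjugate f u"
  using assms conjugate_ge[of u 0 f] by (cases "conjugate f u") auto

lemma conjugate_le:
  assumes "\<And>z. u \<bullet> z - f z \<le> r"
  shows "conjugate f u < \<infinity>" "real_of_ereal (conjugate f u) \<le> r"
proof -
  have le: "conjugate f u \<le> ereal r"
    unfolding conjugate_def using assms by (intro SUP_least) simp
  then show fin: "conjugate f u < \<infinity>"
    by (rule order_le_less_trans) simp
  show "real_of_ereal (conjugate f u) \<le> r"
    using le conjugate_real[OF fin] by (metis ereal_less_eq(3))
qed

lemma support_fun_le_iff: "support_fun u S \<le> ereal r \<longleftrightarrow> (\<forall>z\<in>S. u \<bullet> z \<le> r)"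
  unfolding support_fun_def by (simp add: SUP_le_iff)

text \<open>A penalty vanishing on the diagonal has a conjugate that is finite at most on the
  antidiagonal: this is why one multiplier \<open>v\<close> suffices for both arguments of the penalty.\<close>

lemma affine_minorant_antidiagonal:
  fixes \<phi> :: "'a::real_inner \<times> 'a \<Rightarrow> real"
  assumes "\<And>x. \<phi> (x, x) = 0" "\<And>z. (u, u') \<bullet> z + \<beta> \<le> \<phi> z"
  shows "u' = - u"
proof -
  have "u + u' = 0"
  proof (rule inner_bounded_imp_zero)
    show "(u + u') \<bullet> x \<le> - \<beta>" for x
      using assms(2)[of "(x, x)"] assms(1)[of x] by (simp add: inner_add_left)
  qed
  then show ?thesis by (simp add: eq_neg_iff_add_eq_0 add.commute)
qed

text \<open>The gap in the convexity inequality is exactly \<open>\<tau> * (1 - \<tau>)\<close>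
  times the form at \<open>x - y\<close>; the affine terms cancel.\<close>

lemma convex_on_psd_quadratic:
  assumes "psd L"
  shows "convex_on UNIV (\<lambda>x. x \<bullet> (L *v x) + p \<bullet> x + r)"
proof (rule convex_onI)
  fix \<tau> :: real and x y
  assume \<tau>: "0 < \<tau>" "\<tau> < 1"
  have "0 \<le> \<tau> * (1 - \<tau>) * ((x - y) \<bullet> (L *v (x - y)))"
    using assms \<tau> by (intro mult_nonneg_nonneg) (auto simp: psd_def)
  then show "((1 - \<tau>) *\<^sub>R x + \<tau> *\<^sub>R y) \<bullet> (L *v ((1 - \<tau>) *\<^sub>R x + \<tau> *\<^sub>R y)) +
      p \<bullet> ((1 - \<tau>) *\<^sub>R x + \<tau> *\<^sub>R y) + r
    \<le> (1 - \<tau>) * (x \<bullet> (L *v x) + p \<bullet> x + r) + \<tau> * (y \<bullet> (L *v y) + p \<bullet> y + r)"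
    using psd_inner_commute[OF assms, of x y]
    by (simp add: matrix_vector_mult_diff_distrib matrix_vector_mult_scaleR matrix_vector_right_distrib
        inner_diff_left inner_diff_right inner_add_left inner_add_right algebra_simps)
qed simp

text \<open>From left to right, Fenchel's inequality and the support function bounds are added up.
  Conversely the sandwich lemma is used twice: first to replace the product set by an affine
  function, then to split the quadratic from the penalty. The multiplier \<open>w\<close> belongs to
  \<open>x\<close> in the sample space, \<open>v\<close> to \<open>y\<close> in the core
  set.\<close>

lemma penalized_majorant_iff:
  fixes A :: "real^'l^'p" and B :: "real^'l^'p" and L :: "real^'p^'p"
  assumes L: "psd L" and Z1: "Z\<^sub>1 \<noteq> {}" "convex Z\<^sub>1" and Z2: "Z\<^sub>2 \<noteq> {}" "convex Z\<^sub>2"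
    and \<theta>: "0 < \<theta>" and \<phi>: "convex_on UNIV \<phi>" "\<And>x. \<phi> (x, x) = 0"
  shows "(\<exists>v w z1 z2. conjugate \<phi> (v /\<^sub>R \<theta>, - (v /\<^sub>R \<theta>)) < \<infinity> \<and>
        psd (bordered L ((1/2) *\<^sub>R (v + w + q - a))
          (t - b - c \<bullet> v - c\<^sub>0 \<bullet> w - \<theta> * real_of_ereal (conjugate \<phi> (v /\<^sub>R \<theta>, - (v /\<^sub>R \<theta>))) - z1 - z2)) \<and>
        support_fun (transpose B *v v) Z\<^sub>1 \<le> ereal z1 \<and>
        support_fun (transpose A *v w) Z\<^sub>2 \<le> ereal z2)
    \<longleftrightarrow> (\<forall>x\<in>(\<lambda>\<zeta>. c\<^sub>0 + A *v \<zeta>) ` Z\<^sub>2. \<forall>y\<in>(\<lambda>\<zeta>. c + B *v \<zeta>) ` Z\<^sub>1.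
          a \<bullet> x + b - \<theta> * \<phi> (x, y) \<le> t + q \<bullet> x + x \<bullet> (L *v x))"
    (is "?dual \<longleftrightarrow> ?primal")
proof
  assume ?dual
  then obtain v w z1 z2 where fin: "conjugate \<phi> (v /\<^sub>R \<theta>, - (v /\<^sub>R \<theta>)) < \<infinity>"
    and psd: "psd (bordered L ((1/2) *\<^sub>R (v + w + q - a))
          (t - b - c \<bullet> v - c\<^sub>0 \<bullet> w - \<theta> * real_of_ereal (conjugate \<phi> (v /\<^sub>R \<theta>, - (v /\<^sub>R \<theta>))) - z1 - z2))"
    and z1: "\<And>\<zeta>. \<zeta> \<in> Z\<^sub>1 \<Longrightarrow> (transpose B *v v) \<bullet> \<zeta> \<le> z1"
    and z2: "\<And>\<zeta>. \<zeta> \<in> Z\<^sub>2 \<Longrightarrow> (transpose A *v w) \<bullet> \<zeta> \<le> z2"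
    by (auto simp: support_fun_le_iff)
  define r where "r = real_of_ereal (conjugate \<phi> (v /\<^sub>R \<theta>, - (v /\<^sub>R \<theta>)))"
  \<comment> \<open>\<open>\<theta> * r\<close> is the conjugate of \<open>\<theta> * \<phi>\<close>
    at \<open>(v, - v)\<close>; this is the origin of the scaled arguments.\<close>
  have Fenchel: "v \<bullet> x - v \<bullet> y - \<theta> * \<phi> (x, y) \<le> \<theta> * r" for x y
  proof -
    have "(v /\<^sub>R \<theta>, - (v /\<^sub>R \<theta>)) \<bullet> (x, y) - \<phi> (x, y) \<le> r"
      using conjugate_ge[of "(v /\<^sub>R \<theta>, - (v /\<^sub>R \<theta>))" "(x, y)" \<phi>] conjugate_real[OF fin]
      unfolding r_def by (metis ereal_less_eq(3))
    then show ?thesis using \<theta> by (simp add: field_simps)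
  qed
  have nonneg: "0 \<le> x \<bullet> (L *v x) + (v + w + q - a) \<bullet> x +
      (t - b - c \<bullet> v - c\<^sub>0 \<bullet> w - \<theta> * r - z1 - z2)" for x
    using psd by (simp add: psd_bordered_iff r_def)
  have *: "a \<bullet> x + b - \<theta> * \<phi> (x, y) \<le> t + q \<bullet> x + x \<bullet> (L *v x)"
    if "v \<bullet> y \<le> c \<bullet> v + z1" "w \<bullet> x \<le> c\<^sub>0 \<bullet> w + z2" for x y
    using that nonneg[of x] Fenchel[of x y] by (simp add: inner_add_left inner_diff_left)
  show ?primal
  proof safe
    fix \<zeta> \<zeta>' assume "\<zeta> \<in> Z\<^sub>2" "\<zeta>' \<in> Z\<^sub>1"
    then show "a \<bullet> (c\<^sub>0 + A *v \<zeta>) + b - \<theta> * \<phi> (c\<^sub>0 + A *v \<zeta>, c + B *v \<zeta>')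
        \<le> t + q \<bullet> (c\<^sub>0 + A *v \<zeta>) + (c\<^sub>0 + A *v \<zeta>) \<bullet> (L *v (c\<^sub>0 + A *v \<zeta>))"
      using z1[of \<zeta>'] z2[of \<zeta>]
      by (intro *) (simp_all add: inner_add_right inner_commute[of c] inner_commute[of "c\<^sub>0"]
          dot_lmul_matrix)
  qed
next
  assume primal: ?primal
  \<comment> \<open>The slack of the majorant over the affine piece; \<open>primal\<close> says that
    \<open>Q\<close> plus the scaled penalty is nonnegative on the product set.\<close>
  define Q where "Q x = x \<bullet> (L *v x) + (q - a) \<bullet> x + (t - b)" for x
  have Q: "convex_on UNIV (\<lambda>z :: (real^'p) \<times> (real^'p). Q (fst z))"
    using convex_onD[OF convex_on_psd_quadratic[OF L, of "q - a" "t - b"]]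
    by (intro convex_onI) (auto simp: Q_def)
  have \<theta>\<phi>: "convex_on UNIV (\<lambda>z. \<theta> * \<phi> z)"
    using \<phi>(1) \<theta> by (intro convex_on_cmul) auto
  let ?S = "((\<lambda>\<zeta>. c\<^sub>0 + A *v \<zeta>) ` Z\<^sub>2) \<times> ((\<lambda>\<zeta>. c + B *v \<zeta>) ` Z\<^sub>1)"
  have "convex ((\<lambda>\<zeta>. c\<^sub>0 + A *v \<zeta>) ` Z\<^sub>2)"
    using convex_translation[OF convex_linear_image[OF matrix_vector_mul_linear Z2(2)], of c\<^sub>0 A]
    by (simp add: image_image)
  moreover have "convex ((\<lambda>\<zeta>. c + B *v \<zeta>) ` Z\<^sub>1)"
    using convex_translation[OF convex_linear_image[OF matrix_vector_mul_linear Z1(2)], of c B]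
    by (simp add: image_image)
  ultimately have "convex ?S" by (rule convex_Times)
  then have "convex_on ?S (\<lambda>z. 0)" by (simp add: convex_on_const)
  moreover have "?S \<noteq> {}" using Z1(1) Z2(1) by blast
  moreover have "- 0 \<le> Q (fst z) + \<theta> * \<phi> z" if "z \<in> ?S" for z
  proof -
    obtain x y where z: "z = (x, y)" by fastforce
    have "a \<bullet> x + b - \<theta> * \<phi> (x, y) \<le> t + q \<bullet> x + x \<bullet> (L *v x)"
      using primal that by (auto simp: z)
    then show ?thesis by (simp add: z Q_def inner_diff_left)
  qed
  \<comment> \<open>First split: an affine function that is nonnegative on \<open>?S\<close> and
    lies below quadratic plus penalty on the whole space.\<close>
  ultimately obtain u\<^sub>0 \<beta>\<^sub>0 where
    u\<^sub>0: "\<And>z. u\<^sub>0 \<bullet> z + \<beta>\<^sub>0 \<le> Q (fst z) + \<theta> * \<phi> z" and S: "\<And>z. z \<in> ?S \<Longrightarrow> - 0 \<le> u\<^sub>0 \<bullet> z + \<beta>\<^sub>0"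
    using convex_sandwich[OF convex_on_add[OF Q \<theta>\<phi>], of ?S "\<lambda>z. 0"] by blast
  have "convex_on UNIV (\<lambda>z. Q (fst z) + ((- u\<^sub>0) \<bullet> z - \<beta>\<^sub>0))"
    by (intro convex_on_add Q convex_onI) (auto simp: inner_add_right algebra_simps)
  moreover have "- (Q (fst z) + ((- u\<^sub>0) \<bullet> z - \<beta>\<^sub>0)) \<le> \<theta> * \<phi> z" for z
    using u\<^sub>0[of z] by simp
  \<comment> \<open>Second split: an affine minorant of the penalty alone; what remains of
    \<open>u\<^sub>0\<close> and \<open>\<beta>\<^sub>0\<close> must lie below the
    quadratic.\<close>
  ultimately obtain u \<beta> where u: "\<And>z. u \<bullet> z + \<beta> \<le> \<theta> * \<phi> z"
    and Qu: "\<And>z. - (Q (fst z) + ((- u\<^sub>0) \<bullet> z - \<beta>\<^sub>0)) \<le> u \<bullet> z + \<beta>"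
    using convex_sandwich[OF \<theta>\<phi> _ UNIV_not_empty, of "\<lambda>z. Q (fst z) + ((- u\<^sub>0) \<bullet> z - \<beta>\<^sub>0)"]
    by (metis UNIV_I)
  obtain v v' where uv: "u = (v, v')" by fastforce
  have v': "v' = - v"
    by (rule affine_minorant_antidiagonal[of "\<lambda>z. \<theta> * \<phi> z" v v' \<beta>]) (use u \<phi>(2) in \<open>auto simp: uv\<close>)
  obtain p p' where pp: "u\<^sub>0 = (p, p')" by fastforce
  \<comment> \<open>\<open>Q\<close> ignores the second argument, so the coefficient of
    \<open>y\<close> in its affine lower bound vanishes.\<close>
  have "p' + v = 0"
  proof (rule inner_bounded_imp_zero)
    show "(p' + v) \<bullet> y \<le> Q 0 + \<beta> - \<beta>\<^sub>0" for y
      using Qu[of "(0, y)"] by (simp add: pp uv v' inner_add_left)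
  qed
  then have p': "p' = - v" by (simp add: eq_neg_iff_add_eq_0)
  have Qp: "(p - v) \<bullet> x + \<beta>\<^sub>0 - \<beta> \<le> Q x" for x
    using Qu[of "(x, 0)"] by (simp add: pp uv v' inner_diff_left)
  \<comment> \<open>With this sign, nonnegativity of the first affine function on \<open>?S\<close>
    says that \<open>w \<bullet> x + v \<bullet> y\<close> is at most
    \<open>\<beta>\<^sub>0\<close>.\<close>
  define w where "w = - p"
  \<comment> \<open>\<open>z1\<close> and \<open>z2\<close> are the support function values as real
    suprema. The estimate \<open>bound\<close> controls only a sum; fixing one argument bounds the
    other.\<close>
  define z1 where "z1 = (SUP \<zeta>\<in>Z\<^sub>1. (transpose B *v v) \<bullet> \<zeta>)"
  define z2 where "z2 = (SUP \<zeta>\<in>Z\<^sub>2. (transpose A *v w) \<bullet> \<zeta>)"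
  have bound: "(transpose A *v w) \<bullet> \<zeta> + (transpose B *v v) \<bullet> \<zeta>' + c\<^sub>0 \<bullet> w + c \<bullet> v \<le> \<beta>\<^sub>0"
    if "\<zeta> \<in> Z\<^sub>2" "\<zeta>' \<in> Z\<^sub>1" for \<zeta> \<zeta>'
  proof -
    have "0 \<le> u\<^sub>0 \<bullet> (c\<^sub>0 + A *v \<zeta>, c + B *v \<zeta>') + \<beta>\<^sub>0"
      using S[of "(c\<^sub>0 + A *v \<zeta>, c + B *v \<zeta>')"] that by auto
    then show ?thesis
      by (simp add: pp p' w_def inner_add_right inner_commute[of c] inner_commute[of "c\<^sub>0"]
          dot_lmul_matrix)
  qed
  obtain \<zeta>1 \<zeta>2 where \<zeta>12: "\<zeta>1 \<in> Z\<^sub>1" "\<zeta>2 \<in> Z\<^sub>2" using Z1(1) Z2(1) by blast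
  have bdd1: "bdd_above ((\<lambda>\<zeta>. (transpose B *v v) \<bullet> \<zeta>) ` Z\<^sub>1)"
  proof (rule bdd_aboveI2)
    show "(transpose B *v v) \<bullet> \<zeta> \<le> \<beta>\<^sub>0 - c\<^sub>0 \<bullet> w - c \<bullet> v - (transpose A *v w) \<bullet> \<zeta>2" if "\<zeta> \<in> Z\<^sub>1" for \<zeta>
      using bound[OF \<zeta>12(2) that] by simp
  qed
  have bdd2: "bdd_above ((\<lambda>\<zeta>. (transpose A *v w) \<bullet> \<zeta>) ` Z\<^sub>2)"
  proof (rule bdd_aboveI2)
    show "(transpose A *v w) \<bullet> \<zeta> \<le> \<beta>\<^sub>0 - c\<^sub>0 \<bullet> w - c \<bullet> v - (transpose B *v v) \<bullet> \<zeta>1" if "\<zeta> \<in> Z\<^sub>2" for \<zeta>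
      using bound[OF that \<zeta>12(1)] by simp
  qed
  have "z2 \<le> \<beta>\<^sub>0 - c\<^sub>0 \<bullet> w - c \<bullet> v - (transpose B *v v) \<bullet> \<zeta>'" if "\<zeta>' \<in> Z\<^sub>1" for \<zeta>'
    unfolding z2_def using bound[OF _ that] by (intro cSUP_least[OF Z2(1)]) (simp add: algebra_simps)
  then have z12: "z1 \<le> \<beta>\<^sub>0 - c\<^sub>0 \<bullet> w - c \<bullet> v - z2"
    unfolding z1_def by (intro cSUP_least[OF Z1(1)]) (simp add: algebra_simps)
  have "(v /\<^sub>R \<theta>, - (v /\<^sub>R \<theta>)) \<bullet> z - \<phi> z \<le> - \<beta> / \<theta>" for z
  proof -
    have "(v /\<^sub>R \<theta>, - (v /\<^sub>R \<theta>)) = u /\<^sub>R \<theta>" by (simp add: uv v')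
    then have "(v /\<^sub>R \<theta>, - (v /\<^sub>R \<theta>)) \<bullet> z - \<phi> z = (u \<bullet> z - \<theta> * \<phi> z) / \<theta>"
      using \<theta> by (simp add: field_simps)
    also have "\<dots> \<le> - \<beta> / \<theta>"
      using u[of z] \<theta> by (intro divide_right_mono) simp_all
    finally show ?thesis .
  qed
  note fin = conjugate_le[OF this]
  define r where "r = real_of_ereal (conjugate \<phi> (v /\<^sub>R \<theta>, - (v /\<^sub>R \<theta>)))"
  \<comment> \<open>An affine minorant of \<open>\<theta> * \<phi>\<close> with intercept
    \<open>\<beta>\<close> bounds the conjugate at its slope by \<open>- \<beta>\<close>.\<close>
  have conj: "\<theta> * r \<le> - \<beta>"
    using mult_left_mono[OF fin(2), of \<theta>] \<theta> by (simp add: r_def)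
  show ?dual
  proof (rule exI[of _ v], rule exI[of _ w], rule exI[of _ z1], rule exI[of _ z2], intro conjI)
    show "conjugate \<phi> (v /\<^sub>R \<theta>, - (v /\<^sub>R \<theta>)) < \<infinity>" by (rule fin(1))
    show "support_fun (transpose B *v v) Z\<^sub>1 \<le> ereal z1"
      using cSUP_upper[OF _ bdd1] by (simp add: support_fun_le_iff z1_def)
    show "support_fun (transpose A *v w) Z\<^sub>2 \<le> ereal z2"
      using cSUP_upper[OF _ bdd2] by (simp add: support_fun_le_iff z2_def)
    show "psd (bordered L ((1/2) *\<^sub>R (v + w + q - a))
          (t - b - c \<bullet> v - c\<^sub>0 \<bullet> w - \<theta> * real_of_ereal (conjugate \<phi> (v /\<^sub>R \<theta>, - (v /\<^sub>R \<theta>))) - z1 - z2))"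
      unfolding psd_bordered_iff
    proof (intro conjI L allI)
      fix x
      show "0 \<le> x \<bullet> (L *v x) + 2 * ((1/2) *\<^sub>R (v + w + q - a) \<bullet> x) +
          (t - b - c \<bullet> v - c\<^sub>0 \<bullet> w - \<theta> * real_of_ereal (conjugate \<phi> (v /\<^sub>R \<theta>, - (v /\<^sub>R \<theta>))) - z1 - z2)"
        using Qp[of x] conj z12 unfolding r_def[symmetric]
        by (simp add: Q_def w_def inner_add_left inner_diff_left diff_divide_distrib add_divide_distrib)
    qed
  qed
qed

section \<open>Duality for moment problems\<close>

text \<open>A convex combination is an expectation under a finitely supported measure. The weights
  sit on the indices and are pushed forward to \<open>\<Xi>\<close>, so repeated points require no
  care.\<close>

lemma convex_hull_barycenter:
  fixes f :: "real^'p \<Rightarrow> 'b::euclidean_space"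
  assumes f: "f \<in> borel_measurable (restrict_space borel \<Xi>)" and y: "y \<in> convex hull (f ` \<Xi>)"
  obtains P where "P \<in> prob_measures \<Xi>" "integrable P f" "(\<integral>x. f x \<partial>P) = y"
proof -
  from y obtain k u z where uz: "\<forall>i\<in>{1..k::nat}. 0 \<le> u i \<and> z i \<in> f ` \<Xi>"
    and sum: "sum u {1..k} = 1" "(\<Sum>i = 1..k. u i *\<^sub>R z i) = y"
    unfolding convex_hull_indexed mem_Collect_eq by (elim exE conjE)
  then have u: "\<And>i. i \<in> {1..k} \<Longrightarrow> 0 \<le> u i" and z: "\<And>i. i \<in> {1..k} \<Longrightarrow> z i \<in> f ` \<Xi>"
    by blast+
  have "\<forall>i\<in>{1..k}. \<exists>x. x \<in> \<Xi> \<and> z i = f x"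
    using z by blast
  then obtain x where x: "\<And>i. i \<in> {1..k} \<Longrightarrow> x i \<in> \<Xi> \<and> z i = f (x i)"
    using bchoice[of "{1..k}" "\<lambda>i x. x \<in> \<Xi> \<and> z i = f x"] by blast
  let ?D = "point_measure {1..k} u" and ?B = "restrict_space borel \<Xi>"
  have meas: "x \<in> measurable ?D ?B"
    using x by (auto simp: measurable_point_measure_eq1 space_restrict_space)
  show ?thesis
  proof
    interpret D: prob_space ?D
      by (rule prob_space_point_measure) (use u sum sum_ennreal[of "{1..k}" u] in auto)
    show "distr ?D ?B x \<in> prob_measures \<Xi>"
      using D.prob_space_distr[OF meas] by (simp add: prob_measures_def)
    show "integrable (distr ?D ?B x) f"
      unfolding integrable_distr_eq[OF meas f] by (simp add: integrable_point_measure_finite)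
    have "(\<integral>x. f x \<partial>distr ?D ?B x) = (\<Sum>i\<in>{1..k}. u i *\<^sub>R f (x i))"
      unfolding integral_distr[OF meas f]
      by (rule lebesgue_integral_point_measure_finite) (use u in auto)
    then show "(\<integral>x. f x \<partial>distr ?D ?B x) = y"
      using x sum(2) by simp
  qed
qed

lemma space_prob_measures: "P \<in> prob_measures \<Xi> \<Longrightarrow> space P = \<Xi>"
  using sets_eq_imp_space_eq[of P "restrict_space borel \<Xi>"]
  by (simp add: prob_measures_def space_restrict_space)

section \<open>The ellipsoid of means and weak duality\<close>

lemma matrix_inv_right: "invertible A \<Longrightarrow> A ** matrix_inv A = mat 1"
  unfolding invertible_def matrix_inv_def by (rule someI2_ex) auto

lemma pd_gram_invertible:
  fixes R :: "real^'p^'p"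
  assumes "pd (transpose R ** R)"
  shows "invertible R"
proof -
  have "R *v x = 0 \<Longrightarrow> x = 0" for x
    using assms unfolding pd_def
    by (metis inner_zero_right less_irrefl matrix_vector_mul_assoc matrix_vector_mult_0_right)
  then show ?thesis
    by (simp add: invertible_left_inverse matrix_left_invertible_ker)
qed

text \<open>Substituting \<open>z = transpose R *v y\<close> turns the inverse form into
  \<open>y \<bullet> y\<close>. The ellipsoid of means thus becomes a linear image of a ball, on
  which linear functionals are easy to bound.\<close>

lemma matrix_inv_gram_ellipsoid:
  fixes R :: "real^'p^'p"
  assumes R: "invertible R"
  shows "z \<bullet> (matrix_inv (transpose R ** R) *v z) \<le> \<gamma>
    \<longleftrightarrow> z \<in> (\<lambda>y. transpose R *v y) ` {y. y \<bullet> y \<le> \<gamma>}"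
proof -
  have RT: "invertible (transpose R)" using R by (metis invertible_def matrix_transpose_mul transpose_mat)
  have inv: "invertible (transpose R ** R)" using R RT by (rule invertible_mult[rotated])
  have form: "(transpose R *v y) \<bullet> (matrix_inv (transpose R ** R) *v (transpose R *v y)) = y \<bullet> y" for y
  proof -
    define x where "x = matrix_inv (transpose R ** R) *v (transpose R *v y)"
    have "(transpose R ** R) *v x = transpose R *v y"
      unfolding x_def by (metis matrix_vector_mul_assoc matrix_inv_right[OF inv] matrix_vector_mul_lid)
    then have "transpose R *v (R *v x) = transpose R *v y"
      by (metis matrix_vector_mul_assoc)
    then have "R *v x = y"
      using RT by (metis invertible_def matrix_vector_mul_assoc matrix_vector_mul_lid)
    then show ?thesis unfolding x_def[symmetric] by (simp add: dot_lmul_matrix)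
  qed
  obtain y where "z = transpose R *v y"
    using RT by (metis invertible_def matrix_vector_mul_assoc matrix_vector_mul_lid)
  moreover have "y = y'" if "transpose R *v y = transpose R *v y'" for y y'
    using that RT by (metis invertible_def matrix_vector_mul_assoc matrix_vector_mul_lid)
  ultimately show ?thesis by (auto simp del: transpose_matrix_vector simp: form)
qed

text \<open>The moment constraint is centred at \<open>\<mu>\<close>, the majorant is not;
  translating between them creates \<open>q + 2 *\<^sub>R (L *v \<mu>)\<close> and
  \<open>outer \<mu> \<mu>\<close> in the dual objective.\<close>

lemma quadratic_centering:
  assumes "psd L"
  shows "(x - \<mu>) \<bullet> (L *v (x - \<mu>)) = x \<bullet> (L *v x) - 2 * ((L *v \<mu>) \<bullet> x) + \<mu> \<bullet> (L *v \<mu>)"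
proof -
  have "x \<bullet> (L *v \<mu>) = \<mu> \<bullet> (L *v x)" "(L *v \<mu>) \<bullet> x = \<mu> \<bullet> (L *v x)"
    using psd_inner_commute[OF assms, of x \<mu>] by (simp_all add: inner_commute[of "L *v \<mu>"])
  then show ?thesis
    by (simp add: matrix_vector_mult_diff_distrib inner_diff_left inner_diff_right)
qed

text \<open>The majorant is centred and integrated. Self-duality of the semidefinite cone bounds its
  quadratic term, Cauchy-Schwarz on the ball of radius \<open>sqrt \<gamma>\<^sub>1\<close> its
  linear term.\<close>

lemma moment_weak_duality:
  fixes R L :: "real^'p^'p"
  assumes P: "P \<in> moment_set \<Xi> \<mu> (transpose R ** R) \<gamma>\<^sub>1 \<gamma>\<^sub>2"
    and R: "invertible R" and L: "psd L" and \<gamma>\<^sub>1: "0 \<le> \<gamma>\<^sub>1" and g: "integrable P g"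
    and le: "\<And>x. x \<in> \<Xi> \<Longrightarrow> g x \<le> t + q \<bullet> x + x \<bullet> (L *v x)"
  shows "(\<integral>x. g x \<partial>P) \<le> t + trace_inner L (\<gamma>\<^sub>2 *\<^sub>R (transpose R ** R) + outer \<mu> \<mu>)
    + sqrt \<gamma>\<^sub>1 * norm (R *v (q + 2 *\<^sub>R (L *v \<mu>))) + q \<bullet> \<mu>"
proof -
  define p where "p = q + 2 *\<^sub>R (L *v \<mu>)"
  define e where "e = (\<integral>x. x \<partial>P)"
  define M where "M = (\<integral>x. outer (x - \<mu>) (x - \<mu>) \<partial>P)"
  have P': "P \<in> prob_measures \<Xi>" and intx: "integrable P (\<lambda>x. x)"
    and intM: "integrable P (\<lambda>x. outer (x - \<mu>) (x - \<mu>))"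
    and e: "(e - \<mu>) \<bullet> (matrix_inv (transpose R ** R) *v (e - \<mu>)) \<le> \<gamma>\<^sub>1"
    and M: "psd (\<gamma>\<^sub>2 *\<^sub>R (transpose R ** R) - M)"
    using P by (simp_all add: moment_set_def loewner_le_def e_def M_def)
  interpret prob_space P using P' by (simp add: prob_measures_def)
  obtain y where y: "e - \<mu> = transpose R *v y" "y \<bullet> y \<le> \<gamma>\<^sub>1"
    using e unfolding matrix_inv_gram_ellipsoid[OF R] by blast
  have eq: "t + q \<bullet> x + x \<bullet> (L *v x) = L \<bullet> outer (x - \<mu>) (x - \<mu>) + p \<bullet> x + (t - \<mu> \<bullet> (L *v \<mu>))" for x
    by (simp add: inner_outer quadratic_centering[OF L] p_def inner_add_left)
  have "(\<integral>x. g x \<partial>P) \<le> (\<integral>x. L \<bullet> outer (x - \<mu>) (x - \<mu>) + p \<bullet> x + (t - \<mu> \<bullet> (L *v \<mu>)) \<partial>P)"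
    using le intx intM space_prob_measures[OF P'] unfolding eq by (intro integral_mono g) auto
  also have "\<dots> = L \<bullet> M + p \<bullet> e + (t - \<mu> \<bullet> (L *v \<mu>))"
    using intx intM by (simp add: M_def e_def prob_space)
  finally have "(\<integral>x. g x \<partial>P) \<le> L \<bullet> M + p \<bullet> e + (t - \<mu> \<bullet> (L *v \<mu>))" .
  moreover have "L \<bullet> M \<le> L \<bullet> (\<gamma>\<^sub>2 *\<^sub>R (transpose R ** R))"
    using psd_inner_nonneg[OF L M] by (simp add: inner_diff_right)
  moreover have "p \<bullet> e = p \<bullet> \<mu> + (R *v p) \<bullet> y"
  proof -
    have "e = \<mu> + transpose R *v y" using y(1) by (simp add: algebra_simps)
    then show ?thesis
      by (simp add: inner_add_right inner_commute[of _ y] inner_commute[of p] dot_lmul_matrix)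
  qed
  moreover have "(R *v p) \<bullet> y \<le> norm (R *v p) * sqrt \<gamma>\<^sub>1"
  proof -
    have "norm y \<le> sqrt \<gamma>\<^sub>1"
      using y(2) by (simp add: norm_eq_sqrt_inner)
    then have "norm (R *v p) * norm y \<le> norm (R *v p) * sqrt \<gamma>\<^sub>1"
      by (simp add: mult_left_mono)
    with norm_cauchy_schwarz show ?thesis by (rule order_trans)
  qed
  ultimately have "(\<integral>x. g x \<partial>P) \<le> L \<bullet> (\<gamma>\<^sub>2 *\<^sub>R (transpose R ** R))
      + (p \<bullet> \<mu> + norm (R *v p) * sqrt \<gamma>\<^sub>1) + (t - \<mu> \<bullet> (L *v \<mu>))"
    by linarith
  \<comment> \<open>Here \<open>p \<bullet> \<mu> - \<mu> \<bullet> (L *v \<mu>)\<close> regroups to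
    \<open>q \<bullet> \<mu> + L \<bullet> outer \<mu> \<mu>\<close>.\<close>
  then show ?thesis
    by (simp add: trace_inner_eq_inner inner_add_right inner_outer p_def inner_add_left
        inner_commute[of "L *v \<mu>"] mult.commute)
qed

section \<open>Strong duality by separation of moment vectors\<close>

lemma outer_continuous: "continuous_on UNIV (\<lambda>x. outer (x - \<mu>) (x - \<mu>))"
  unfolding outer_def by (intro continuous_on_vec_lambda continuous_intros)

text \<open>Converts a direction in which a separated set is unbounded into a sign condition on the
  separating functional.\<close>

lemma affine_nonneg_slope:
  fixes \<beta> :: real
  assumes "\<And>s. 0 \<le> s \<Longrightarrow> s\<^sub>0 \<le> s \<Longrightarrow> \<alpha> \<le> \<beta> + s * \<sigma>"
  shows "0 \<le> \<sigma>"
proof (rule ccontr)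
  assume "\<not> 0 \<le> \<sigma>"
  then have \<sigma>: "\<sigma> < 0" by simp
  define s where "s = max (max 0 s\<^sub>0) ((\<alpha> - \<beta> - 1) / \<sigma>)"
  have s: "0 \<le> s" "s\<^sub>0 \<le> s" "(\<alpha> - \<beta> - 1) / \<sigma> \<le> s"
    by (auto simp: s_def)
  have "s * \<sigma> \<le> (\<alpha> - \<beta> - 1) / \<sigma> * \<sigma>"
    using \<sigma> s(3) by (intro mult_right_mono_neg) auto
  also have "\<dots> = \<alpha> - \<beta> - 1" using \<sigma> by simp
  finally show False using assms[OF s(1,2)] by linarith
qed

text \<open>The convex hull of the generalized moments of the points of \<open>\<Xi>\<close> is separated from the
  admissible moments combined with a value above \<open>V\<close>. The Dirac measure at \<open>\<mu>\<close> satisfies both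
  moment constraints strictly, so the separating hyperplane is not vertical (\<open>\<rho> \<noteq> 0\<close>); this also
  yields attainment.\<close>

lemma moment_strong_duality:
  fixes R :: "real^'p^'p" and g :: "real^'p \<Rightarrow> real"
  assumes \<mu>: "\<mu> \<in> \<Xi>" and pd: "pd (transpose R ** R)" and \<gamma>: "0 < \<gamma>\<^sub>1" "0 < \<gamma>\<^sub>2"
    and g: "g \<in> borel_measurable (restrict_space borel \<Xi>)"
    and V: "\<And>P. P \<in> moment_set \<Xi> \<mu> (transpose R ** R) \<gamma>\<^sub>1 \<gamma>\<^sub>2 \<Longrightarrow> (\<integral>x. g x \<partial>P) \<le> V"
  obtains L q t where "psd L" "\<And>x. x \<in> \<Xi> \<Longrightarrow> g x \<le> t + q \<bullet> x + x \<bullet> (L *v x)"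
    "t + trace_inner L (\<gamma>\<^sub>2 *\<^sub>R (transpose R ** R) + outer \<mu> \<mu>)
      + sqrt \<gamma>\<^sub>1 * norm (R *v (q + 2 *\<^sub>R (L *v \<mu>))) + q \<bullet> \<mu> \<le> V"
proof -
  define \<Sigma> where "\<Sigma> = transpose R ** R"
  have R: "invertible R" by (rule pd_gram_invertible[OF pd])
  define F where "F x = (x, outer (x - \<mu>) (x - \<mu>), g x)" for x
  define U where "U = {y::real^'p. norm y \<le> sqrt \<gamma>\<^sub>1}"
  \<comment> \<open>Symmetry is not imposed: second moments are symmetric by themselves, and the
    skew directions contained in \<open>C\<close> will force the multiplier \<open>K\<close> to be
    symmetric.\<close>
  define C where "C = {S. \<forall>x. S \<bullet> outer x x \<le> \<gamma>\<^sub>2 * (x \<bullet> (\<Sigma> *v x))}"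
  define T where "T = ((\<lambda>y. \<mu> + transpose R *v y) ` U) \<times> C \<times> {V<..}"
  have U0: "0 \<in> U" using \<gamma> by (simp add: U_def)
  have \<Sigma>_nonneg: "0 \<le> x \<bullet> (\<Sigma> *v x)" for x
    using pd by (cases "x = 0") (auto simp: pd_def \<Sigma>_def less_imp_le)
  have \<Sigma>_symm: "transpose \<Sigma> = \<Sigma>" using pd by (simp add: pd_def \<Sigma>_def)
  have "convex C"
  proof -
    have "C = (\<Inter>x. {S. outer x x \<bullet> S \<le> \<gamma>\<^sub>2 * (x \<bullet> (\<Sigma> *v x))})"
      by (auto simp: C_def inner_commute)
    then show ?thesis by (simp add: convex_INT convex_halfspace_le)
  qed
  moreover have "convex ((\<lambda>y. \<mu> + transpose R *v y) ` U)"
  proof -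
    have "U = cball 0 (sqrt \<gamma>\<^sub>1)" by (auto simp: U_def)
    then have "convex U" by simp
    from convex_translation[OF convex_linear_image[OF matrix_vector_mul_linear this], of \<mu> "transpose R"]
    show ?thesis by (simp add: image_image)
  qed
  ultimately have "convex T" unfolding T_def by (intro convex_Times) auto
  \<comment> \<open>A common point would be the moment vector of an admissible measure whose
    integral exceeds \<open>V\<close>.\<close>
  have disjoint: "(convex hull (F ` \<Xi>)) \<inter> T = {}"
  proof (rule ccontr)
    assume "(convex hull (F ` \<Xi>)) \<inter> T \<noteq> {}"
    then obtain z where z: "z \<in> convex hull (F ` \<Xi>)" "z \<in> T" by blast
    have F: "F \<in> borel_measurable (restrict_space borel \<Xi>)"
      unfolding F_def
      by (intro borel_measurable_Pair g measurable_restrict_space1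
          borel_measurable_continuous_onI outer_continuous continuous_on_id)
    obtain P where P: "P \<in> prob_measures \<Xi>" "integrable P F" "(\<integral>x. F x \<partial>P) = z"
      using convex_hull_barycenter[OF F z(1)] by blast
    interpret prob_space P using P(1) by (simp add: prob_measures_def)
    note lin = bounded_linear_fst bounded_linear_fst_comp[OF bounded_linear_snd]
      bounded_linear_snd_comp[OF bounded_linear_snd]
    note int = lin[THEN integrable_bounded_linear, OF P(2), unfolded F_def fst_conv snd_conv]
    note z_eq = lin[THEN integral_bounded_linear, OF P(2), unfolded P(3), unfolded F_def fst_conv snd_conv]
    obtain y where y: "y \<in> U" "fst z - \<mu> = transpose R *v y"
      and C: "fst (snd z) \<in> C" and less: "V < snd (snd z)"
      using z(2) by (auto simp: T_def)
    have "transpose (fst (snd z)) = (\<integral>x. transpose (outer (x - \<mu>) (x - \<mu>)) \<partial>P)"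
      unfolding z_eq(2)[symmetric]
      by (rule integral_bounded_linear[OF _ int(2), symmetric])
         (auto intro!: linear_conv_bounded_linear[THEN iffD1] linearI simp: transpose_def vec_eq_iff)
    then have "transpose (fst (snd z)) = fst (snd z)"
      by (simp add: transpose_outer z_eq(2))
    then have "transpose (\<gamma>\<^sub>2 *\<^sub>R \<Sigma> - fst (snd z)) = \<gamma>\<^sub>2 *\<^sub>R \<Sigma> - fst (snd z)"
      using \<Sigma>_symm by (simp add: transpose_def vec_eq_iff)
    then have "psd (\<gamma>\<^sub>2 *\<^sub>R \<Sigma> - fst (snd z))"
      using C unfolding psd_def C_def inner_outer[symmetric]
      by (simp add: inner_diff_left)
    moreover have "(fst z - \<mu>) \<bullet> (matrix_inv \<Sigma> *v (fst z - \<mu>)) \<le> \<gamma>\<^sub>1"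
      using y unfolding \<Sigma>_def matrix_inv_gram_ellipsoid[OF R] U_def
      by (auto simp: norm_eq_sqrt_inner)
    moreover have "{x \<in> space P. x \<in> \<Xi>} = space P"
      using space_prob_measures[OF P(1)] by blast
    ultimately have "P \<in> moment_set \<Xi> \<mu> \<Sigma> \<gamma>\<^sub>1 \<gamma>\<^sub>2"
      using P(1) int(1,2) by (simp add: moment_set_def z_eq loewner_le_def prob_space)
    from V[OF this[unfolded \<Sigma>_def]] z_eq(3) less show False by simp
  qed
  have C0: "0 \<in> C"
    using \<Sigma>_nonneg \<gamma> by (simp add: C_def)
  have "(\<mu> + transpose R *v 0, 0, V + 1) \<in> T"
    unfolding T_def using U0 C0 by (intro SigmaI imageI) simp_all
  then have T: "T \<noteq> {}" by blast
  have "convex hull (F ` \<Xi>) \<noteq> {}" using \<mu> by auto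
  from separating_hyperplane_sets[OF convex_convex_hull \<open>convex T\<close> this T disjoint]
  obtain w \<tau> where w: "w \<noteq> 0" "\<forall>z\<in>convex hull (F ` \<Xi>). w \<bullet> z \<le> \<tau>" "\<forall>z\<in>T. \<tau> \<le> w \<bullet> z"
    by (elim exE conjE) blast
  obtain \<beta> K \<rho> where w_eq: "w = (\<beta>, K, \<rho>)" by (cases w) auto
  have \<Xi>le: "\<beta> \<bullet> x + (x - \<mu>) \<bullet> (K *v (x - \<mu>)) + \<rho> * g x \<le> \<tau>" if "x \<in> \<Xi>" for x
  proof -
    have "F x \<in> convex hull (F ` \<Xi>)" using that by (simp add: hull_inc)
    with w(2) show ?thesis by (auto simp: w_eq F_def inner_outer)
  qed
  have Tge: "\<tau> \<le> \<beta> \<bullet> \<mu> + (R *v \<beta>) \<bullet> y + K \<bullet> S + \<rho> * r" if "y \<in> U" "S \<in> C" "V < r" for y S r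
  proof -
    have "(\<mu> + transpose R *v y, S, r) \<in> T"
      unfolding T_def using that by (intro SigmaI imageI) simp_all
    with w(3) have "\<tau> \<le> w \<bullet> (\<mu> + transpose R *v y, S, r)" by blast
    then show ?thesis
      by (simp add: w_eq inner_add_right inner_commute[of _ y] inner_commute[of \<beta> "_ v* _"] dot_lmul_matrix)
  qed
  have "0 \<le> \<rho>"
  proof (rule affine_nonneg_slope)
    show "\<tau> \<le> \<beta> \<bullet> \<mu> + s * \<rho>" if "V + 1 \<le> s" for s
      using Tge[OF U0 C0, of s] that by (simp add: mult.commute)
  qed
  \<comment> \<open>\<open>C\<close> is unbounded in every direction
    \<open>- outer x x\<close>.\<close>
  have K_nonpos: "x \<bullet> (K *v x) \<le> 0" for x
  proof -
    have "0 \<le> - (x \<bullet> (K *v x))"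
    proof (rule affine_nonneg_slope)
      show "\<tau> \<le> (\<beta> \<bullet> \<mu> + \<rho> * (V + 1)) + s * - (x \<bullet> (K *v x))" if "0 \<le> s" for s
      proof -
        have "(- s) *\<^sub>R outer x x \<in> C"
          unfolding C_def
        proof safe
          fix y
          have "((- s) *\<^sub>R outer x x) \<bullet> outer y y = - (s * (x \<bullet> y)\<^sup>2)"
            by (simp add: inner_outer outer_mult_vec power2_eq_square inner_commute)
          moreover have "0 \<le> s * (x \<bullet> y)\<^sup>2" "0 \<le> \<gamma>\<^sub>2 * (y \<bullet> (\<Sigma> *v y))"
            using that \<gamma> \<Sigma>_nonneg by simp_all
          ultimately show "((- s) *\<^sub>R outer x x) \<bullet> outer y y \<le> \<gamma>\<^sub>2 * (y \<bullet> (\<Sigma> *v y))"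
            by linarith
        qed
        from Tge[OF U0 this, of "V + 1"] show ?thesis
          by (simp add: inner_outer[of K])
      qed
    qed
    then show ?thesis by simp
  qed
  have K_symm: "transpose K = K"
  proof -
    have quad: "transpose K \<bullet> outer x x = K \<bullet> outer x x" for x
      using inner_transpose_transpose[of K "outer x x"] by (simp add: transpose_outer)
    \<comment> \<open>\<open>transpose K - K\<close> has zero quadratic form, so all its multiples
      lie in \<open>C\<close>.\<close>
    have "0 \<le> K \<bullet> (transpose K - K)"
    proof (rule affine_nonneg_slope)
      show "\<tau> \<le> (\<beta> \<bullet> \<mu> + \<rho> * (V + 1)) + s * (K \<bullet> (transpose K - K))" for s
      proof -
        have "s *\<^sub>R (transpose K - K) \<in> C"
          using \<gamma> \<Sigma>_nonneg quad
by (simp add: C_def inner_diff_left)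
        from Tge[OF U0 this, of "V + 1"] show ?thesis by simp
      qed
    qed
    moreover have "(transpose K - K) \<bullet> (transpose K - K) = - 2 * (K \<bullet> (transpose K - K))"
      using inner_transpose_transpose[of K K]
      by (simp add: inner_diff_left inner_diff_right inner_commute[of "transpose K" K])
    ultimately have "(transpose K - K) \<bullet> (transpose K - K) \<le> 0" by simp
    then have "transpose K - K = 0" by (metis inner_ge_zero inner_eq_zero_iff order_antisym)
    then show ?thesis by simp
  qed
  \<comment> \<open>The minimiser of \<open>(R *v \<beta>) \<bullet> y\<close> over
    \<open>U\<close>; if \<open>R *v \<beta> = 0\<close>, division by zero gives 0, which is a
    minimiser as well.\<close>
  define y\<^sub>0 where "y\<^sub>0 = (- sqrt \<gamma>\<^sub>1 / norm (R *v \<beta>)) *\<^sub>R (R *v \<beta>)"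
  have y\<^sub>0: "y\<^sub>0 \<in> U" "(R *v \<beta>) \<bullet> y\<^sub>0 = - sqrt \<gamma>\<^sub>1 * norm (R *v \<beta>)"
    using \<gamma> by (auto simp: y\<^sub>0_def U_def dot_square_norm power2_eq_square)
  have "\<rho> \<noteq> 0"
  proof
    assume \<rho>: "\<rho> = 0"
    have \<tau>: "\<beta> \<bullet> \<mu> \<le> \<tau>" using \<Xi>le[OF \<mu>] \<rho> by simp
    \<comment> \<open>The Dirac bound on \<open>\<tau>\<close> leaves no room for a decrease away
      from the centre of the ellipsoid.\<close>
    have "0 \<le> - sqrt \<gamma>\<^sub>1 * norm (R *v \<beta>)"
      using Tge[OF y\<^sub>0(1) C0, of "V + 1"] y\<^sub>0(2) \<tau> \<rho> by simp
    then have "R *v \<beta> = 0"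
      using \<gamma> by (simp add: mult_le_0_iff)
    then have "\<beta> = 0"
      using R by (metis invertible_def matrix_vector_mul_assoc matrix_vector_mul_lid matrix_vector_mult_0_right)
    \<comment> \<open>The square of \<open>\<kappa>\<close> bounds the eigenvalues of
      \<open>\<Sigma>\<close> from below, so that \<open>C\<close> contains a ball around 0.\<close>
    obtain \<kappa> where \<kappa>: "0 < \<kappa>" "\<And>x. \<kappa> * norm x \<le> norm (R *v x)"
    proof -
      have "inj ((*v) R)"
        using R by (simp add: inj_matrix_vector_mult)
      then show ?thesis
        using linear_inj_bounded_below_pos[OF matrix_vector_mul_linear, of R] that by (auto simp: mult.commute)
    qed
    \<comment> \<open>Small enough for \<open>(- \<epsilon>) *\<^sub>R K\<close> to lie in that
      ball, where the functional would be negative unless \<open>K = 0\<close>; the added 1 keeps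
      the denominator positive.\<close>
    define \<epsilon> where "\<epsilon> = \<gamma>\<^sub>2 * \<kappa>\<^sup>2 / (norm K + 1)"
    have \<epsilon>: "0 < \<epsilon>" "\<epsilon> * norm K \<le> \<gamma>\<^sub>2 * \<kappa>\<^sup>2"
      using \<gamma> \<kappa> by (auto simp: \<epsilon>_def field_simps add_pos_nonneg add_nonneg_pos)
    have "(- \<epsilon>) *\<^sub>R K \<in> C"
      unfolding C_def
    proof safe
      fix x
      have "((- \<epsilon>) *\<^sub>R K) \<bullet> outer x x \<le> norm ((- \<epsilon>) *\<^sub>R K) * (x \<bullet> x)"
        using norm_cauchy_schwarz[of "(- \<epsilon>) *\<^sub>R K" "outer x x"]
        by (simp add: norm_outer dot_square_norm power2_eq_square)
      also have "\<dots> \<le> (\<gamma>\<^sub>2 * \<kappa>\<^sup>2) * (x \<bullet> x)"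
        using \<epsilon> by (intro mult_right_mono) auto
      also have "\<dots> = \<gamma>\<^sub>2 * (\<kappa> * norm x)\<^sup>2"
        by (simp add: dot_square_norm power_mult_distrib)
      also have "\<dots> \<le> \<gamma>\<^sub>2 * (norm (R *v x))\<^sup>2"
        using \<kappa> \<gamma> by (intro mult_left_mono power_mono) auto
      also have "(norm (R *v x))\<^sup>2 = x \<bullet> (\<Sigma> *v x)"
        by (simp add: \<Sigma>_def dot_square_norm[symmetric] inner_commute[of x] dot_lmul_matrix
            flip: matrix_vector_mul_assoc)
      finally show "((- \<epsilon>) *\<^sub>R K) \<bullet> outer x x \<le> \<gamma>\<^sub>2 * (x \<bullet> (\<Sigma> *v x))" .
    qed
    from Tge[OF U0 this, of "V + 1"] have "\<epsilon> * (K \<bullet> K) \<le> 0"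
      using \<tau> \<rho> by simp
    then have "K \<bullet> K \<le> 0" using \<epsilon>(1) by (simp add: mult_le_0_iff)
    then have "K = 0" by (metis inner_ge_zero inner_eq_zero_iff order_antisym)
    with \<open>\<beta> = 0\<close> \<rho> w(1) show False by (simp add: w_eq zero_prod_def)
  qed
  with \<open>0 \<le> \<rho>\<close> have \<rho>: "0 < \<rho>" by simp
  \<comment> \<open>The inequality on \<open>\<Xi>\<close> is solved for \<open>g\<close>;
    \<open>q\<close> and \<open>t\<close> then undo the centring at \<open>\<mu>\<close>.\<close>
  define L where "L = (- 1 / \<rho>) *\<^sub>R K"
  define p where "p = (- 1 / \<rho>) *\<^sub>R \<beta>"
  define q where "q = p - 2 *\<^sub>R (L *v \<mu>)"
  define t where "t = \<tau> / \<rho> + \<mu> \<bullet> (L *v \<mu>)"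
  have Lv: "x \<bullet> (L *v x) = - (x \<bullet> (K *v x)) / \<rho>" for x
    unfolding inner_outer[symmetric] L_def by simp
  have L: "psd L"
  proof -
    have "transpose L = L" using K_symm by (simp add: L_def transpose_def vec_eq_iff)
    moreover have "0 \<le> x \<bullet> (L *v x)" for x
      using K_nonpos[of x] \<rho> unfolding Lv by (intro divide_nonneg_pos) simp_all
    ultimately show ?thesis by (simp add: psd_def)
  qed
  show ?thesis
  proof (rule that[where L = L and q = q and t = t, OF L])
    fix x assume "x \<in> \<Xi>"
    then have "\<rho> * g x \<le> \<tau> - \<beta> \<bullet> x - (x - \<mu>) \<bullet> (K *v (x - \<mu>))"
      using \<Xi>le[of x] by simp
    then have "g x \<le> (\<tau> - \<beta> \<bullet> x - (x - \<mu>) \<bullet> (K *v (x - \<mu>))) / \<rho>"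
      using \<rho> by (simp add: pos_le_divide_eq mult.commute)
    then have "g x \<le> \<tau> / \<rho> + p \<bullet> x + (x - \<mu>) \<bullet> (L *v (x - \<mu>))"
      unfolding Lv by (simp add: p_def diff_divide_distrib)
    then show "g x \<le> t + q \<bullet> x + x \<bullet> (L *v x)"
      unfolding quadratic_centering[OF L] q_def t_def by (simp add: inner_diff_left)
  next
    \<comment> \<open>The functional on \<open>T\<close> is evaluated where it is smallest: at
      \<open>y\<^sub>0\<close>, at this matrix, and at values decreasing to
      \<open>V\<close>.\<close>
    have "\<gamma>\<^sub>2 *\<^sub>R \<Sigma> \<in> C" unfolding C_def inner_outer[symmetric] by simp
    have "\<tau> - (\<beta> \<bullet> \<mu> - sqrt \<gamma>\<^sub>1 * norm (R *v \<beta>) + \<gamma>\<^sub>2 * (K \<bullet> \<Sigma>)) \<le> \<rho> * V"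
    proof (rule field_le_epsilon)
      fix e :: real assume "0 < e"
      then have "V < V + e / \<rho>" using \<rho> by simp
      from Tge[OF y\<^sub>0(1) \<open>\<gamma>\<^sub>2 *\<^sub>R \<Sigma> \<in> C\<close> this]
      show "\<tau> - (\<beta> \<bullet> \<mu> - sqrt \<gamma>\<^sub>1 * norm (R *v \<beta>) + \<gamma>\<^sub>2 * (K \<bullet> \<Sigma>)) \<le> \<rho> * V + e"
        using y\<^sub>0(2) \<rho> by (simp add: distrib_left)
    qed
    then have "(\<tau> - (\<beta> \<bullet> \<mu> - sqrt \<gamma>\<^sub>1 * norm (R *v \<beta>) + \<gamma>\<^sub>2 * (K \<bullet> \<Sigma>))) / \<rho> \<le> V"
      using \<rho> by (simp add: pos_divide_le_eq mult.commute)
    moreover have "R *v p = (- 1 / \<rho>) *\<^sub>R (R *v \<beta>)"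
      by (simp only: p_def matrix_vector_mult_scaleR)
    then have "norm (R *v p) = norm (R *v \<beta>) / \<rho>"
      using \<rho> by simp
    moreover have "p \<bullet> \<mu> = - (\<beta> \<bullet> \<mu>) / \<rho>" "L \<bullet> \<Sigma> = - (K \<bullet> \<Sigma>) / \<rho>"
      by (simp_all add: p_def L_def)
    ultimately have "\<tau> / \<rho> + p \<bullet> \<mu> + sqrt \<gamma>\<^sub>1 * norm (R *v p) + \<gamma>\<^sub>2 * (L \<bullet> \<Sigma>) \<le> V"
      by (simp add: diff_divide_distrib add_divide_distrib)
    then show "t + trace_inner L (\<gamma>\<^sub>2 *\<^sub>R (transpose R ** R) + outer \<mu> \<mu>)
      + sqrt \<gamma>\<^sub>1 * norm (R *v (q + 2 *\<^sub>R (L *v \<mu>))) + q \<bullet> \<mu> \<le> V"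
      unfolding trace_inner_eq_inner inner_add_right inner_outer t_def q_def \<Sigma>_def[symmetric]
      by (simp add: inner_diff_left inner_commute[of "L *v \<mu>"])
  qed
qed

text \<open>The mean is \<open>\<mu>\<close> and the second moment about it is zero. This makes the
  moment problem feasible.\<close>

lemma dirac_moment_set:
  assumes "\<mu> \<in> \<Xi>" "0 < \<gamma>\<^sub>1" "0 < \<gamma>\<^sub>2" "pd \<Sigma>"
  shows "return (restrict_space borel \<Xi>) \<mu> \<in> moment_set \<Xi> \<mu> \<Sigma> \<gamma>\<^sub>1 \<gamma>\<^sub>2"
proof -
  let ?B = "restrict_space borel \<Xi>"
  let ?P = "return ?B \<mu>"
  have \<mu>: "\<mu> \<in> space ?B" using assms(1) by (simp add: space_restrict_space)
  have meas: "(\<lambda>x. x) \<in> borel_measurable ?B" "(\<lambda>x. outer (x - \<mu>) (x - \<mu>)) \<in> borel_measurable ?B"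
    by (intro measurable_restrict_space1 borel_measurable_continuous_onI outer_continuous continuous_on_id)+
  have P: "?P \<in> prob_measures \<Xi>"
    using prob_space_return[OF \<mu>] by (simp add: prob_measures_def)
  have "integrable ?P f" if "f \<in> borel_measurable ?B" for f :: "real^'a \<Rightarrow> 'b::{banach,second_countable_topology}"
    using that \<mu> by (intro integrableI_bounded) (simp_all add: nn_integral_return)
  note int = this[OF meas(1)] this[OF meas(2)]
  have "outer (\<mu> - \<mu>) (\<mu> - \<mu>) = 0" by (simp add: outer_def vec_eq_iff)
  then have "(\<integral>x. x \<partial>?P) = \<mu>" "(\<integral>x. outer (x - \<mu>) (x - \<mu>) \<partial>?P) = 0"
    using integral_return[OF \<mu> meas(1)] integral_return[OF \<mu> meas(2)] by simp_all
  moreover have "psd (\<gamma>\<^sub>2 *\<^sub>R \<Sigma>)"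
  proof -
    have "transpose (\<gamma>\<^sub>2 *\<^sub>R \<Sigma>) = \<gamma>\<^sub>2 *\<^sub>R \<Sigma>"
      using assms(4) by (simp add: pd_def transpose_def vec_eq_iff)
    moreover have "0 \<le> x \<bullet> ((\<gamma>\<^sub>2 *\<^sub>R \<Sigma>) *v x)" for x
    proof -
      have "0 \<le> x \<bullet> (\<Sigma> *v x)"
        using assms(4) by (cases "x = 0") (auto simp: pd_def less_imp_le)
      then show ?thesis
        using assms(3) unfolding inner_outer[symmetric] by simp
    qed
    ultimately show ?thesis by (simp add: psd_def)
  qed
  moreover have "{x \<in> space ?P. x \<in> \<Xi>} = space ?P"
    using space_prob_measures[OF P] by blast
  moreover have "measure ?P (space ?P) = 1"
    by (rule prob_space.prob_space[OF prob_space_return[OF \<mu>]])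
  ultimately show ?thesis
    using P int assms(2) by (simp add: moment_set_def loewner_le_def)
qed

text \<open>Joins weak and strong duality. The bound \<open>ub\<close> keeps the supremum below
  infinity and the Dirac measure keeps it above minus infinity, so there is a real \<open>V\<close>
  to separate from.\<close>

lemma moment_problem_duality:
  fixes R :: "real^'p^'p" and g :: "real^'p \<Rightarrow> real"
  assumes \<mu>: "\<mu> \<in> \<Xi>" and pd: "pd (transpose R ** R)" and \<gamma>: "0 < \<gamma>\<^sub>1" "0 < \<gamma>\<^sub>2"
    and D: "D = moment_set \<Xi> \<mu> (transpose R ** R) \<gamma>\<^sub>1 \<gamma>\<^sub>2"
    and int: "\<And>P. P \<in> D \<Longrightarrow> integrable P g"
    and ub: "\<And>x. x \<in> \<Xi> \<Longrightarrow> g x \<le> x \<bullet> x + r"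
    and dual: "\<And>L q t. dual L q t = t + trace_inner L (\<gamma>\<^sub>2 *\<^sub>R (transpose R ** R) + outer \<mu> \<mu>)
      + sqrt \<gamma>\<^sub>1 * norm (R *v (q + 2 *\<^sub>R (L *v \<mu>))) + q \<bullet> \<mu>"
  shows "psd L \<Longrightarrow> \<forall>x\<in>\<Xi>. g x \<le> t + q \<bullet> x + x \<bullet> (L *v x) \<Longrightarrow>
      (SUP P\<in>D. ereal (\<integral>x. g x \<partial>P)) \<le> ereal (dual L q t)"
    and "\<exists>L q t. psd L \<and> (\<forall>x\<in>\<Xi>. g x \<le> t + q \<bullet> x + x \<bullet> (L *v x)) \<and>
      (SUP P\<in>D. ereal (\<integral>x. g x \<partial>P)) = ereal (dual L q t)"
proof -
  have R: "invertible R" by (rule pd_gram_invertible[OF pd])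
  have weak: "(SUP P\<in>D. ereal (\<integral>x. g x \<partial>P)) \<le> ereal (dual L q t)"
    if "psd L" "\<forall>x\<in>\<Xi>. g x \<le> t + q \<bullet> x + x \<bullet> (L *v x)" for L q t
  proof (rule SUP_least)
    fix P assume "P \<in> D"
    then show "ereal (\<integral>x. g x \<partial>P) \<le> ereal (dual L q t)"
      using moment_weak_duality[OF _ R that(1) _ int] that(2) \<gamma>(1) by (simp add: D dual)
  qed
  then show "psd L \<Longrightarrow> \<forall>x\<in>\<Xi>. g x \<le> t + q \<bullet> x + x \<bullet> (L *v x) \<Longrightarrow>
      (SUP P\<in>D. ereal (\<integral>x. g x \<partial>P)) \<le> ereal (dual L q t)" .
  let ?\<delta> = "return (restrict_space borel \<Xi>) \<mu>"
  have \<delta>: "?\<delta> \<in> D" unfolding D by (rule dirac_moment_set[OF \<mu> \<gamma> pd])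
  \<comment> \<open>Integrability under one admissible measure gives measurability on
    \<open>\<Xi>\<close>, since its sigma-algebra is the trace of the Borel sets.\<close>
  have g: "g \<in> borel_measurable (restrict_space borel \<Xi>)"
    using borel_measurable_integrable[OF int[OF \<delta>]] by simp
  \<comment> \<open>The bound \<open>ub\<close> read as the majorant with \<open>L = mat 1\<close>,
    \<open>q = 0\<close> and \<open>t = r\<close>.\<close>
  have "psd (mat 1 :: real^'p^'p)" by (simp add: psd_def transpose_mat)
  then have "(SUP P\<in>D. ereal (\<integral>x. g x \<partial>P)) \<le> ereal (dual (mat 1) 0 r)"
    by (rule weak) (use ub in \<open>simp add: add.commute\<close>)
  moreover have "ereal (\<integral>x. g x \<partial>?\<delta>) \<le> (SUP P\<in>D. ereal (\<integral>x. g x \<partial>P))"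
    using \<delta> by (rule SUP_upper)
  ultimately obtain V where V: "(SUP P\<in>D. ereal (\<integral>x. g x \<partial>P)) = ereal V"
    by (cases "SUP P\<in>D. ereal (\<integral>x. g x \<partial>P)") auto
  have "(\<integral>x. g x \<partial>P) \<le> V" if "P \<in> moment_set \<Xi> \<mu> (transpose R ** R) \<gamma>\<^sub>1 \<gamma>\<^sub>2" for P
  proof -
    have "ereal (\<integral>x. g x \<partial>P) \<le> ereal V"
      unfolding V[symmetric] using that by (intro SUP_upper) (simp add: D)
    then show ?thesis by simp
  qed
  from moment_strong_duality[OF \<mu> pd \<gamma> g this]
  obtain L q t where L: "psd L" "\<And>x. x \<in> \<Xi> \<Longrightarrow> g x \<le> t + q \<bullet> x + x \<bullet> (L *v x)"
    and le: "dual L q t \<le> V"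
    unfolding dual by metis
  then have "(SUP P\<in>D. ereal (\<integral>x. g x \<partial>P)) = ereal (dual L q t)"
    using weak[of L t q] by (intro antisym) (simp_all add: V)
  with L show "\<exists>L q t. psd L \<and> (\<forall>x\<in>\<Xi>. g x \<le> t + q \<bullet> x + x \<bullet> (L *v x)) \<and>
      (SUP P\<in>D. ereal (\<integral>x. g x \<partial>P)) = ereal (dual L q t)"
    by (intro exI[of _ L] exI[of _ q] exI[of _ t]) simp
qed

text \<open>The finite maximum and minimum are attained. The infimum over \<open>Y i\<close> may not
  be: it is treated as a greatest lower bound after division by \<open>\<theta> i\<close>, and
  nonnegativity of \<open>\<phi>\<close> keeps it bounded below.\<close>

lemma Max_minus_Min_Inf_le_iff:
  fixes f :: "'k \<Rightarrow> real" and \<phi> :: "'i \<Rightarrow> 'y \<Rightarrow> real"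
  assumes fin: "finite J" "J \<noteq> {}" "finite I" "I \<noteq> {}"
    and \<theta>: "\<And>i. i \<in> I \<Longrightarrow> 0 < \<theta> i" and Y: "\<And>i. i \<in> I \<Longrightarrow> Y i \<noteq> {}"
    and \<phi>: "\<And>i y. i \<in> I \<Longrightarrow> 0 \<le> \<phi> i y"
  shows "(MAX k\<in>J. f k) - (MIN i\<in>I. \<theta> i * (INF y\<in>Y i. \<phi> i y)) \<le> r
    \<longleftrightarrow> (\<forall>i\<in>I. \<forall>k\<in>J. \<forall>y\<in>Y i. f k - \<theta> i * \<phi> i y \<le> r)" (is "?l \<longleftrightarrow> ?r")
proof
  assume ?l
  show ?r
  proof safe
    fix i k y assume *: "i \<in> I" "k \<in> J" "y \<in> Y i"
    have "f k \<le> (MAX k\<in>J. f k)" using * fin by simp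
    moreover have "(MIN i\<in>I. \<theta> i * (INF y\<in>Y i. \<phi> i y)) \<le> \<theta> i * (INF y\<in>Y i. \<phi> i y)"
      using * fin by simp
    moreover have "(INF y\<in>Y i. \<phi> i y) \<le> \<phi> i y"
      using * \<phi> by (intro cINF_lower bdd_belowI2[of _ 0]) auto
    then have "\<theta> i * (INF y\<in>Y i. \<phi> i y) \<le> \<theta> i * \<phi> i y"
      using \<theta>[OF *(1)] by simp
    ultimately show "f k - \<theta> i * \<phi> i y \<le> r" using \<open>?l\<close> by linarith
  qed
next
  assume r: ?r
  have "(MAX k\<in>J. f k) \<in> f ` J" using fin by (intro Max_in) auto
  then obtain k where k: "k \<in> J" "(MAX k\<in>J. f k) = f k" by blast
  have "(MIN i\<in>I. \<theta> i * (INF y\<in>Y i. \<phi> i y)) \<in> (\<lambda>i. \<theta> i * (INF y\<in>Y i. \<phi> i y)) ` I"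
    using fin by (intro Min_in) auto
  then obtain i where i: "i \<in> I" "(MIN i\<in>I. \<theta> i * (INF y\<in>Y i. \<phi> i y)) = \<theta> i * (INF y\<in>Y i. \<phi> i y)"
    by blast
  have "(f k - r) / \<theta> i \<le> (INF y\<in>Y i. \<phi> i y)"
  proof (rule cINF_greatest[OF Y[OF i(1)]])
    fix y assume "y \<in> Y i"
    then have "f k - \<theta> i * \<phi> i y \<le> r" using r i(1) k(1) by blast
    then show "(f k - r) / \<theta> i \<le> \<phi> i y"
      using \<theta>[OF i(1)] by (simp add: pos_divide_le_eq mult.commute)
  qed
  then show ?l
    using \<theta>[OF i(1)] unfolding i k by (simp add: pos_divide_le_eq mult.commute)
qed

section \<open>The reformulation\<close>

text \<open>An attained minimum over each fibre \<open>F x\<close> allows minimisers to be passed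
  between the nested and the joint problem.\<close>

lemma attained_infimum_nested:
  fixes V :: "'x \<Rightarrow> ereal" and obj :: "'y \<Rightarrow> real"
  assumes le: "\<And>x y. x \<in> X \<Longrightarrow> y \<in> F x \<Longrightarrow> V x \<le> ereal (obj y)"
    and att: "\<And>x. x \<in> X \<Longrightarrow> \<exists>y\<in>F x. V x = ereal (obj y)"
  shows "(\<forall>x\<in>X. V x = (INF y\<in>F x. ereal (obj y))) \<and>
    (INF x\<in>X. V x) = (INF (x, y)\<in>Sigma X F. ereal (obj y)) \<and>
    {x \<in> X. V x < \<infinity> \<and> (\<forall>x'\<in>X. V x \<le> V x')} =
      {x \<in> X. \<exists>y\<in>F x. \<forall>(x', y')\<in>Sigma X F. obj y \<le> obj y'}"
proof (intro conjI ballI)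
  fix x assume x: "x \<in> X"
  then obtain y where y: "y \<in> F x" "V x = ereal (obj y)" using att by blast
  show "V x = (INF y\<in>F x. ereal (obj y))"
  proof (rule antisym)
    show "V x \<le> (INF y\<in>F x. ereal (obj y))" using le[OF x] by (rule INF_greatest)
    show "(INF y\<in>F x. ereal (obj y)) \<le> V x" unfolding y(2) using y(1) by (rule INF_lower)
  qed
next
  show "(INF x\<in>X. V x) = (INF (x, y)\<in>Sigma X F. ereal (obj y))"
  proof (rule antisym)
    show "(INF x\<in>X. V x) \<le> (INF (x, y)\<in>Sigma X F. ereal (obj y))"
    proof (rule INF_greatest)
      fix z assume "z \<in> Sigma X F"
      then obtain x y where z: "z = (x, y)" and xy: "x \<in> X" "y \<in> F x" by blast
      have "(INF x\<in>X. V x) \<le> V x" using xy(1) by (rule INF_lower)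
      also have "\<dots> \<le> ereal (obj y)" using xy by (rule le)
      finally show "(INF x\<in>X. V x) \<le> (case z of (x, y) \<Rightarrow> ereal (obj y))" by (simp add: z)
    qed
    show "(INF (x, y)\<in>Sigma X F. ereal (obj y)) \<le> (INF x\<in>X. V x)"
    proof (rule INF_greatest)
      fix x assume x: "x \<in> X"
      then obtain y where y: "y \<in> F x" "V x = ereal (obj y)" using att by blast
      then show "(INF (x, y)\<in>Sigma X F. ereal (obj y)) \<le> V x"
        using INF_lower[of "(x, y)" "Sigma X F" "\<lambda>(x, y). ereal (obj y)"] x by simp
    qed
  qed
next
  show "{x \<in> X. V x < \<infinity> \<and> (\<forall>x'\<in>X. V x \<le> V x')} =
      {x \<in> X. \<exists>y\<in>F x. \<forall>(x', y')\<in>Sigma X F. obj y \<le> obj y'}" (is "?A = ?B")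
  proof (intro equalityI subsetI)
    fix x assume "x \<in> ?A"
    then have x: "x \<in> X" and min: "\<And>x'. x' \<in> X \<Longrightarrow> V x \<le> V x'" by auto
    obtain y where y: "y \<in> F x" "V x = ereal (obj y)" using att[OF x] by blast
    have "obj y \<le> obj y'" if "x' \<in> X" "y' \<in> F x'" for x' y'
    proof -
      have "ereal (obj y) \<le> ereal (obj y')"
        using order_trans[OF min[OF that(1)] le[OF that]] by (simp add: y(2))
      then show ?thesis by simp
    qed
    then show "x \<in> ?B" using x y(1) by (auto intro!: bexI[of _ y])
  next
    fix x assume "x \<in> ?B"
    then obtain y where x: "x \<in> X" "y \<in> F x"
      and min: "\<And>x' y'. x' \<in> X \<Longrightarrow> y' \<in> F x' \<Longrightarrow> obj y \<le> obj y'" by auto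
    have Vx: "V x \<le> ereal (obj y)" using x by (rule le)
    have "V x \<le> V x'" if x': "x' \<in> X" for x'
    proof -
      obtain y' where y': "y' \<in> F x'" "V x' = ereal (obj y')" using att[OF x'] by blast
      have "ereal (obj y) \<le> V x'" using min[OF x' y'(1)] by (simp add: y'(2))
      with Vx show ?thesis by (rule order_trans)
    qed
    moreover have "V x < \<infinity>" using Vx by (rule order_le_less_trans) simp
    ultimately show "x \<in> ?A" using x(1) by simp
  qed
qed

text \<open>An infinite conjugate is excluded in \<open>F\<close> by an explicit constraint, since
  \<open>real_of_ereal\<close> would read it as 0. Optimal values are extended reals because the
  infimum over \<open>X\<close> may be infinite.\<close>

theorem theorem2p1:
  fixes X :: "(real^'n) set"
    and a :: "nat \<Rightarrow> real^'n \<Rightarrow> real^'p" and b :: "nat \<Rightarrow> real^'n \<Rightarrow> real"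
    and h :: "real^'n \<Rightarrow> real^'p \<Rightarrow> real"
    and K m N :: nat
    and s :: "nat \<Rightarrow> real^'p" and d :: real
    and \<mu>\<^sub>0 :: "real^'p" and \<Sigma>\<^sub>0 R :: "real^'p^'p"
    and \<gamma>\<^sub>1 \<gamma>\<^sub>2 :: real
    and c\<^sub>0 :: "real^'p" and c :: "nat \<Rightarrow> real^'p"
    and A :: "real^'l^'p" and B :: "nat \<Rightarrow> real^'l^'p"
    and Z\<^sub>1 :: "nat \<Rightarrow> (real^'l) set" and Z\<^sub>2 :: "(real^'l) set"
    and Y :: "nat \<Rightarrow> (real^'p) set" and \<Xi> :: "(real^'p) set"
    and \<theta> :: "nat \<Rightarrow> real" and \<phi> :: "nat \<Rightarrow> (real^'p) \<times> (real^'p) \<Rightarrow> real"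
    and D :: "(real^'p) measure set"
    and G :: "real^'n \<Rightarrow> real^'p \<Rightarrow> real"
    and V :: "real^'n \<Rightarrow> ereal"
    and F :: "real^'n \<Rightarrow>
        ((real^'p^'p) \<times> (real^'p) \<times> real \<times> (nat \<Rightarrow> nat \<Rightarrow> real^'p) \<times> (nat \<Rightarrow> nat \<Rightarrow> real^'p) \<times>
          (nat \<Rightarrow> nat \<Rightarrow> real) \<times> (nat \<Rightarrow> nat \<Rightarrow> real)) set"
    and obj :: "(real^'p^'p) \<times> (real^'p) \<times> real \<times> (nat \<Rightarrow> nat \<Rightarrow> real^'p) \<times> (nat \<Rightarrow> nat \<Rightarrow> real^'p) \<times>
          (nat \<Rightarrow> nat \<Rightarrow> real) \<times> (nat \<Rightarrow> nat \<Rightarrow> real) \<Rightarrow> real"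
  assumes X: "closed X" "convex X"
    and sizes: "1 \<le> K" "1 \<le> m" "1 \<le> N"
    and lin: "\<And>k. k \<in> {1..K} \<Longrightarrow> linear (a k)" "\<And>k. k \<in> {1..K} \<Longrightarrow> linear (b k)"
    and h: "h = (\<lambda>x \<xi>. MAX k\<in>{1..K}. a k x \<bullet> \<xi> + b k x)"
    and Z1: "\<And>i. i \<in> {1..m} \<Longrightarrow> Z\<^sub>1 i \<noteq> {}" "\<And>i. i \<in> {1..m} \<Longrightarrow> convex (Z\<^sub>1 i)"
      "\<And>i. i \<in> {1..m} \<Longrightarrow> compact (Z\<^sub>1 i)" "\<And>i. i \<in> {1..m} \<Longrightarrow> 0 \<in> rel_interior (Z\<^sub>1 i)"
    and Z2: "convex Z\<^sub>2"
    and Y: "Y = (\<lambda>i. {c i + B i *v \<zeta> | \<zeta>. \<zeta> \<in> Z\<^sub>1 i})"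
    and Xi: "\<Xi> = {c\<^sub>0 + A *v \<zeta> | \<zeta>. \<zeta> \<in> Z\<^sub>2}"
    and sub: "\<And>i. i \<in> {1..m} \<Longrightarrow> Y i \<subseteq> \<Xi>"
    and samples: "\<And>j. j \<in> {1..N} \<Longrightarrow> s j \<in> \<Xi>"
    and mu: "\<mu>\<^sub>0 = sample_mean N s"
    and sigma: "d = real N \<or> d = real N - 1" "\<Sigma>\<^sub>0 = sample_covariance d N s" "pd \<Sigma>\<^sub>0"
    and root: "\<Sigma>\<^sub>0 = transpose R ** R"
    and gamma: "0 < \<gamma>\<^sub>1" "0 < \<gamma>\<^sub>2"
    and theta: "\<And>i. i \<in> {1..m} \<Longrightarrow> 0 < \<theta> i"
    and phi: "\<And>i. i \<in> {1..m} \<Longrightarrow> closed (epigraph UNIV (\<phi> i))"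
      "\<And>i. i \<in> {1..m} \<Longrightarrow> convex_on UNIV (\<phi> i)"
      "\<And>i \<xi> \<xi>'. i \<in> {1..m} \<Longrightarrow> 0 \<le> \<phi> i (\<xi>, \<xi>')"
      "\<And>i \<xi>. i \<in> {1..m} \<Longrightarrow> \<phi> i (\<xi>, \<xi>) = 0"
    and D: "D = moment_set \<Xi> \<mu>\<^sub>0 \<Sigma>\<^sub>0 \<gamma>\<^sub>1 \<gamma>\<^sub>2"
    and G: "G = (\<lambda>x \<xi>. h x \<xi> - (MIN i\<in>{1..m}. \<theta> i * (INF \<xi>'\<in>Y i. \<phi> i (\<xi>, \<xi>'))))"
    and int: "\<And>x P. x \<in> X \<Longrightarrow> P \<in> D \<Longrightarrow> integrable P (G x)"
    and V: "V = (\<lambda>x. SUP P\<in>D. ereal (\<integral>\<xi>. G x \<xi> \<partial>P))"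
    and F: "F = (\<lambda>x. {(\<Lambda>, q, t, v, w, z1, z2). psd \<Lambda> \<and>
        (\<forall>i\<in>{1..m}. \<forall>k\<in>{1..K}.
          conjugate (\<phi> i) (v i k /\<^sub>R \<theta> i, - (v i k /\<^sub>R \<theta> i)) < \<infinity> \<and>
          psd (bordered \<Lambda> ((1/2) *\<^sub>R (v i k + w i k + q - a k x))
            (t - b k x - c i \<bullet> v i k - c\<^sub>0 \<bullet> w i k
              - \<theta> i * real_of_ereal (conjugate (\<phi> i) (v i k /\<^sub>R \<theta> i, - (v i k /\<^sub>R \<theta> i)))
              - z1 i k - z2 i k)) \<and>
          support_fun (transpose (B i) *v v i k) (Z\<^sub>1 i) \<le> ereal (z1 i k) \<and>
          support_fun (transpose A *v w i k) Z\<^sub>2 \<le> ereal (z2 i k))})"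
    and obj: "obj = (\<lambda>(\<Lambda>, q, t, v, w, z1, z2).
        t + trace_inner \<Lambda> (\<gamma>\<^sub>2 *\<^sub>R \<Sigma>\<^sub>0 + outer \<mu>\<^sub>0 \<mu>\<^sub>0)
          + sqrt \<gamma>\<^sub>1 * norm (R *v (q + 2 *\<^sub>R (\<Lambda> *v \<mu>\<^sub>0))) + q \<bullet> \<mu>\<^sub>0)"
  shows "(\<forall>x\<in>X. V x = (INF y\<in>F x. ereal (obj y))) \<and>
    (INF x\<in>X. V x) = (INF (x, y)\<in>Sigma X F. ereal (obj y)) \<and>
    {x \<in> X. V x < \<infinity> \<and> (\<forall>x'\<in>X. V x \<le> V x')} =
      {x \<in> X. \<exists>y\<in>F x. \<forall>(x', y')\<in>Sigma X F. obj y \<le> obj y'}"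
proof -
  have Xi_image: "\<Xi> = (\<lambda>\<zeta>. c\<^sub>0 + A *v \<zeta>) ` Z\<^sub>2" using Xi by auto
  have Y_image: "Y i = (\<lambda>\<zeta>. c i + B i *v \<zeta>) ` Z\<^sub>1 i" for i using Y by auto
  have "convex \<Xi>"
    using convex_translation[OF convex_linear_image[OF matrix_vector_mul_linear Z2], of "c\<^sub>0" A]
    by (simp add: Xi_image image_image)
  then have "(\<Sum>j=1..N. (1 / real N) *\<^sub>R s j) \<in> \<Xi>"
    using sizes(3) by (intro convex_sum) (auto intro: samples)
  then have \<mu>: "\<mu>\<^sub>0 \<in> \<Xi>" by (simp add: mu sample_mean_def scaleR_right.sum)
  then have Z2_nonempty: "Z\<^sub>2 \<noteq> {}" by (auto simp: Xi_image)
  have G_le_iff: "G x \<xi> \<le> r \<longleftrightarrow>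
      (\<forall>i\<in>{1..m}. \<forall>k\<in>{1..K}. \<forall>\<xi>'\<in>Y i. a k x \<bullet> \<xi> + b k x - \<theta> i * \<phi> i (\<xi>, \<xi>') \<le> r)" for x \<xi> r
    unfolding G h
    by (rule Max_minus_Min_Inf_le_iff) (use sizes theta phi(3) Z1(1) in \<open>auto simp: Y_image\<close>)
  \<comment> \<open>The constraints for one pair \<open>(i, k)\<close>: different pairs share only
    \<open>x\<close>, \<open>\<Lambda>\<close>, \<open>q\<close> and \<open>t\<close>, so their
    multipliers can be found separately.\<close>
  define con where "con x \<Lambda> q t i k v w z1 z2 \<longleftrightarrow>
      conjugate (\<phi> i) (v /\<^sub>R \<theta> i, - (v /\<^sub>R \<theta> i)) < \<infinity> \<and>
      psd (bordered \<Lambda> ((1/2) *\<^sub>R (v + w + q - a k x))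
        (t - b k x - c i \<bullet> v - c\<^sub>0 \<bullet> w
          - \<theta> i * real_of_ereal (conjugate (\<phi> i) (v /\<^sub>R \<theta> i, - (v /\<^sub>R \<theta> i))) - z1 - z2)) \<and>
      support_fun (transpose (B i) *v v) (Z\<^sub>1 i) \<le> ereal z1 \<and>
      support_fun (transpose A *v w) Z\<^sub>2 \<le> ereal z2" for x \<Lambda> q t i k v w z1 z2
  have F_iff: "(\<Lambda>, q, t, v, w, z1, z2) \<in> F x \<longleftrightarrow> psd \<Lambda> \<and>
      (\<forall>i\<in>{1..m}. \<forall>k\<in>{1..K}. con x \<Lambda> q t i k (v i k) (w i k) (z1 i k) (z2 i k))"
    for x \<Lambda> q t v w z1 z2
    unfolding F con_def by simp
  have con_iff: "(\<exists>v w z1 z2. con x \<Lambda> q t i k v w z1 z2) \<longleftrightarrow>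
      (\<forall>\<xi>\<in>\<Xi>. \<forall>\<xi>'\<in>Y i. a k x \<bullet> \<xi> + b k x - \<theta> i * \<phi> i (\<xi>, \<xi>') \<le> t + q \<bullet> \<xi> + \<xi> \<bullet> (\<Lambda> *v \<xi>))"
    if "psd \<Lambda>" "i \<in> {1..m}" for x \<Lambda> q t i k
    unfolding con_def Xi_image Y_image
    using that by (intro penalized_majorant_iff Z1 Z2 Z2_nonempty theta phi)
  define dual where "dual \<Lambda> q t = t + trace_inner \<Lambda> (\<gamma>\<^sub>2 *\<^sub>R (transpose R ** R) + outer \<mu>\<^sub>0 \<mu>\<^sub>0)
      + sqrt \<gamma>\<^sub>1 * norm (R *v (q + 2 *\<^sub>R (\<Lambda> *v \<mu>\<^sub>0))) + q \<bullet> \<mu>\<^sub>0" for \<Lambda> q t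
  have obj_eq: "obj (\<Lambda>, q, t, v, w, z1, z2) = dual \<Lambda> q t" for \<Lambda> q t v w z1 z2
    by (simp add: obj dual_def root)
  have majorant: "\<forall>\<xi>\<in>\<Xi>. G x \<xi> \<le> t + q \<bullet> \<xi> + \<xi> \<bullet> (\<Lambda> *v \<xi>)"
    if "(\<Lambda>, q, t, v, w, z1, z2) \<in> F x" for x \<Lambda> q t v w z1 z2
    unfolding G_le_iff using that con_iff[of \<Lambda> _ x q t] unfolding F_iff by blast
  have multipliers: "\<exists>v w z1 z2. (\<Lambda>, q, t, v, w, z1, z2) \<in> F x"
    if "psd \<Lambda>" "\<forall>\<xi>\<in>\<Xi>. G x \<xi> \<le> t + q \<bullet> \<xi> + \<xi> \<bullet> (\<Lambda> *v \<xi>)" for x \<Lambda> q t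
  proof -
    \<comment> \<open>The four multipliers are bundled into a tuple so that one application of
      choice serves all pairs.\<close>
    let ?C = "\<lambda>p y. con x \<Lambda> q t (fst p) (snd p) (fst y) (fst (snd y)) (fst (snd (snd y))) (snd (snd (snd y)))"
    have "\<forall>p\<in>{1..m} \<times> {1..K}. \<exists>y. ?C p y"
    proof safe
      fix i k assume ik: "i \<in> {1..m}" "k \<in> {1..K}"
      then have "\<exists>v w z1 z2. con x \<Lambda> q t i k v w z1 z2"
        using that(2) unfolding con_iff[OF that(1) ik(1)] G_le_iff by blast
      then obtain v w z1 z2 where "con x \<Lambda> q t i k v w z1 z2" by (elim exE)
      then show "\<exists>y. ?C (i, k) y" by (intro exI[of _ "(v, w, z1, z2)"]) simp
    qed
    from bchoice[OF this] obtain y where y: "\<forall>p\<in>{1..m} \<times> {1..K}. ?C p (y p)" by (elim exE)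
    show ?thesis
      unfolding F_iff
      by (rule exI[of _ "\<lambda>i k. fst (y (i, k))"], rule exI[of _ "\<lambda>i k. fst (snd (y (i, k)))"],
          rule exI[of _ "\<lambda>i k. fst (snd (snd (y (i, k))))"],
          rule exI[of _ "\<lambda>i k. snd (snd (snd (y (i, k))))"])
        (use that(1) y in auto)
  qed
  \<comment> \<open>Expanding the square of \<open>\<xi> - a k x\<close> bounds the linear term; the
    sum over \<open>k\<close> is one constant valid for all pieces.\<close>
  have bound: "G x \<xi> \<le> \<xi> \<bullet> \<xi> + (\<Sum>k\<in>{1..K}. a k x \<bullet> a k x + \<bar>b k x\<bar>)" for x \<xi>
    unfolding G_le_iff
  proof (intro ballI)
    fix i k \<xi>' assume ik: "i \<in> {1..m}" "k \<in> {1..K}"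
    have "0 \<le> (\<xi> - a k x) \<bullet> (\<xi> - a k x)" by simp
    then have "2 * (a k x \<bullet> \<xi>) \<le> \<xi> \<bullet> \<xi> + a k x \<bullet> a k x"
      by (simp add: inner_diff_left inner_diff_right inner_commute)
    moreover have "0 \<le> \<xi> \<bullet> \<xi>" "0 \<le> a k x \<bullet> a k x" by simp_all
    moreover have "a k x \<bullet> a k x + \<bar>b k x\<bar> \<le> (\<Sum>k\<in>{1..K}. a k x \<bullet> a k x + \<bar>b k x\<bar>)"
      using ik(2) by (intro member_le_sum) auto
    moreover have "0 \<le> \<theta> i * \<phi> i (\<xi>, \<xi>')"
      using theta[OF ik(1)] phi(3)[OF ik(1)] by simp
    ultimately show "a k x \<bullet> \<xi> + b k x - \<theta> i * \<phi> i (\<xi>, \<xi>')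
        \<le> \<xi> \<bullet> \<xi> + (\<Sum>k\<in>{1..K}. a k x \<bullet> a k x + \<bar>b k x\<bar>)"
      by linarith
  qed
  have "pd (transpose R ** R)" using sigma(3) by (simp add: root)
  note duality = moment_problem_duality[OF \<mu> this gamma D[unfolded root] int bound dual_def]
  show ?thesis
  proof (rule attained_infimum_nested)
    fix x y assume x: "x \<in> X" and y: "y \<in> F x"
    obtain \<Lambda> q t v w z1 z2 where y_eq: "y = (\<Lambda>, q, t, v, w, z1, z2)" by (cases y)
    have "psd \<Lambda>" using y by (simp add: y_eq F_iff)
    then show "V x \<le> ereal (obj y)"
      using duality(1)[OF x] majorant[OF y[unfolded y_eq]] by (simp add: V y_eq obj_eq)
  next
    fix x assume x: "x \<in> X"
    have "\<exists>\<Lambda> q t. psd \<Lambda> \<and> (\<forall>\<xi>\<in>\<Xi>. G x \<xi> \<le> t + q \<bullet> \<xi> + \<xi> \<bullet> (\<Lambda> *v \<xi>)) \<and>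
        V x = ereal (dual \<Lambda> q t)"
      unfolding V by (rule duality(2)[OF x])
    then obtain \<Lambda> q t where \<Lambda>: "psd \<Lambda>"
      "\<forall>\<xi>\<in>\<Xi>. G x \<xi> \<le> t + q \<bullet> \<xi> + \<xi> \<bullet> (\<Lambda> *v \<xi>)" and Vx: "V x = ereal (dual \<Lambda> q t)"
      by (elim exE conjE)
    from multipliers[OF \<Lambda>] obtain v w z1 z2 where F: "(\<Lambda>, q, t, v, w, z1, z2) \<in> F x"
      by (elim exE)
    show "\<exists>y\<in>F x. V x = ereal (obj y)"
      by (rule bexI[OF _ F]) (simp add: Vx obj_eq)
  qed
qed

end
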